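(* Let $q$ be a prime power. Let $NG_0=1$ and, for $n\ge 1$, let $NG_n$ be the number of ordered pairs $(A,B)$ of commuting nilpotent $n\times n$ matrices over $\mathbb{F}_q$ (both $A$ and $B$ nilpotent, $AB=BA$). Then \[ \sum_{n \geq 0} \frac{NG_n u^n}{|\mathrm{GL}(n,q)|} = \prod_{i \geq 1} \prod_{l \geq 1} \frac{1}{1-u^i/q^l} .\]
   Context: $\mathrm{GL}(n,q)$ is the group of invertible $n\times n$ matrices over $\mathbb{F}_q$, with the convention $|\mathrm{GL}(0,q)|=1$. The identity is one of power series in $u$ with real coefficients (the infinite product converging coefficientwise). *)

theory Defs
  imports
    "HOL-Analysis.Analysis"
    "HOL-Computational_Algebra.Formal_Power_Series"
    "Jordan_Normal_Form.Matrix"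
begin

(* The field F_q is a type 'a :: {field, finite} with CARD('a) = q.  The size n of the matrices
   is a variable ranging over all naturals, hence 'a mat with the carriers carrier_mat n n. *)

definition nilpotent_mat :: "'a :: semiring_1 mat \<Rightarrow> bool" where
  "nilpotent_mat A \<longleftrightarrow>
     square_mat A \<and> (\<exists>k. A ^\<^sub>m k = 0\<^sub>m (dim_row A) (dim_row A))"

definition commuting_nilpotent_pairs :: "nat \<Rightarrow> ('a :: semiring_1 mat \<times> 'a mat) set" where
  "commuting_nilpotent_pairs n =
     {(A, B). A \<in> carrier_mat n n \<and> B \<in> carrier_mat n n \<and>
              nilpotent_mat A \<and> nilpotent_mat B \<and> A * B = B * A}"

definition GL :: "nat \<Rightarrow> 'a :: semiring_1 mat set" where
  "GL n = {A \<in> carrier_mat n n. invertible_mat A}"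

(* Neither set needs a separate convention at n = 0: the empty matrix is the only element
   of carrier_mat 0 0. *)

lemma carrier_mat_0_0: "A \<in> carrier_mat 0 0 \<longleftrightarrow> A = 1\<^sub>m 0"
  by (metis carrier_matD eq_matI less_nat_zero_code one_carrier_mat)

lemma card_commuting_nilpotent_pairs_0:
  "card (commuting_nilpotent_pairs 0 :: ('a :: semiring_1 mat \<times> 'a mat) set) = 1"
proof -
  have "(1\<^sub>m 0 :: 'a mat) ^\<^sub>m 0 = 0\<^sub>m 0 0"
    by (rule eq_matI) simp_all
  hence "nilpotent_mat (1\<^sub>m 0 :: 'a mat)"
    unfolding nilpotent_mat_def by (intro conjI exI[of _ 0]) simp_all
  hence "(commuting_nilpotent_pairs 0 :: ('a mat \<times> 'a mat) set) = {(1\<^sub>m 0, 1\<^sub>m 0)}"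
    unfolding commuting_nilpotent_pairs_def carrier_mat_0_0 by fastforce
  thus ?thesis by simp
qed

lemma card_GL_0: "card (GL 0 :: 'a :: semiring_1 mat set) = 1"
proof -
  have "invertible_mat (1\<^sub>m 0 :: 'a mat)"
    unfolding invertible_mat_def inverts_mat_def
    by (intro conjI exI[of _ "1\<^sub>m 0"]) simp_all
  hence "(GL 0 :: 'a mat set) = {1\<^sub>m 0}"
    unfolding GL_def carrier_mat_0_0 by auto
  thus ?thesis by simp
qed

lemma finite_carrier_mat: "finite (carrier_mat m n :: 'a :: finite mat set)"
proof -
  let ?I = "{0..<m} \<times> {0..<n}"
  have "(carrier_mat m n :: 'a mat set) \<subseteq> mat m n ` (?I \<rightarrow>\<^sub>E UNIV)"
  proof
    fix A :: "'a mat" assume A: "A \<in> carrier_mat m n"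
    have "A = mat m n (restrict (($$) A) ?I)"
      using A by (intro eq_matI) simp_all
    moreover have "restrict (($$) A) ?I \<in> ?I \<rightarrow>\<^sub>E UNIV"
      by (simp add: restrict_def PiE_def extensional_def)
    ultimately show "A \<in> mat m n ` (?I \<rightarrow>\<^sub>E UNIV)" by (rule image_eqI)
  qed
  moreover have "finite (?I \<rightarrow>\<^sub>E (UNIV :: 'a set))"
    by (intro finite_PiE) auto
  ultimately show ?thesis by (meson finite_imageI finite_subset)
qed

(* The product of f 1, f 2, ..., each coefficient of the partial products converging in the usual
   topology of the reals.  The library's has_prod on fps is not suitable: the topology of fps asks
   each coefficient to become eventually constant. *)

definition fps_has_infprod :: "(nat \<Rightarrow> real fps) \<Rightarrow> real fps \<Rightarrow> bool" where
  "fps_has_infprod f F \<longleftrightarrow>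
     (\<forall>n. (\<lambda>N. fps_nth (\<Prod>i=1..N. f i) n) \<longlonglongrightarrow> fps_nth F n)"

definition fps_convergent_infprod :: "(nat \<Rightarrow> real fps) \<Rightarrow> bool" where
  "fps_convergent_infprod f \<longleftrightarrow> (\<exists>F. fps_has_infprod f F)"

definition fps_infprod :: "(nat \<Rightarrow> real fps) \<Rightarrow> real fps" where
  "fps_infprod f = (THE F. fps_has_infprod f F)"

lemma fps_has_infprod_unique: "fps_has_infprod f F \<Longrightarrow> fps_has_infprod f G \<Longrightarrow> F = G"
  unfolding fps_has_infprod_def by (intro fps_ext) (blast intro: LIMSEQ_unique)

lemma fps_infprod_eqI: "fps_has_infprod f F \<Longrightarrow> fps_infprod f = F"
  unfolding fps_infprod_def by (rule the_equality) (simp_all add: fps_has_infprod_unique)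

end

(* Let V have dimension n and let A, B be commuting nilpotent maps on V with dim ker A = m.  Both maps
   restrict to the image W = A(V), of dimension n - m.  Conversely, fix a commuting nilpotent pair (a, b)
   on W with dim ker a = m'.  Counting the extensions of a to some A with A(V) = W, and then the nilpotent
   extensions B of b commuting with A, and dividing by |GL(n,q)|, one finds for the normalised
   count D(n,m) the recursion
     D(n,m) = sum over m' <= m of D(n-m,m') * w(m-m'),   w(k) = q^(k(k-1)) / |GL(k,q)|,
   where q^(k(k-1)) is the number of nilpotent k x k matrices.  Put
     G_k(u) = sum over n, m of D(n,m) u^(n+km)   and   E(x) = sum over k of w(k) x^k.
   The recursion says G_k(u) = E(u^(k+1)) G_(k+1)(u), so G_0, the generating function of the theorem,
   is the product of the E(u^i) over i >= 1.  Finally E(x) is the product of 1 / (1 - x/q^l) over l >= 1,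
   by Euler's q-series identity. *)

theory Submission
  imports
    Defs
    "HOL-Library.Function_Algebras"
begin

section \<open>Linear maps between finite subspaces\<close>

text \<open>The recursion descends to images, kernels and complements, none of which is a standard
  F_q^n. The counting is therefore done for linear maps on arbitrary finite subspaces of one vector
  space, and matrices enter only at the end. A single weight survives for the following reason.
  Given (a, b) on W, the numbers of choices depend only on dimensions: up to powers of q, A is a
  surjection from a complement of W, of dimension m, onto W / a(W), of dimension m', and B is a
  nilpotent map on ker A / ker a, of dimension m-m'. Division by |GL(n,q)| cancels every power of q
  that comes from choices modulo a kernel or an image, and of the group orders only |GL(m-m',q)|
  remains. The exponent n+km makes the recursion factor, because n+km = (n-m) + (k+1)m' +
  (k+1)(m-m'). The two products converge differently: G_k agrees with 1 below degree k, so the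
  coefficients of the outer partial products become constant, whereas those of the inner ones only
  tend to a limit.\<close>

locale finite_field_space = vector_space scale
  for scale :: "'a::{field,finite} \<Rightarrow> 'v::ab_group_add \<Rightarrow> 'v" (infixr "\<star>" 75) +
  fixes q :: nat
  assumes q_card: "q = CARD('a)"
begin

section \<open>Dimension by cardinality, direct sums and complements\<close>

lemma q_ge_2: "q \<ge> 2"
proof -
  have "card {0, 1::'a} \<le> CARD('a)" by (intro card_mono) auto
  thus ?thesis by (simp add: q_card)
qed

text \<open>Over a finite field the dimension can be read off the cardinality. Uniqueness,
  monotonicity and rank-nullity then become statements about powers of \<open>q\<close>, and no
  bases are carried around.\<close>

definition has_dim :: "'v set \<Rightarrow> nat \<Rightarrow> bool" where
  "has_dim V n \<longleftrightarrow> subspace V \<and> card V = q ^ n"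

text \<open>Functions are extensional, undefined off \<open>V\<close>, so that each linear map on
  \<open>V\<close> has one representative and cardinalities count maps rather than their
  continuations to the whole type.\<close>

definition lin_maps :: "'v set \<Rightarrow> 'v set \<Rightarrow> ('v \<Rightarrow> 'v) set" where
  "lin_maps V U = {f \<in> V \<rightarrow>\<^sub>E U. (\<forall>x\<in>V. \<forall>y\<in>V. f (x + y) = f x + f y) \<and> (\<forall>c. \<forall>x\<in>V. f (c \<star> x) = c \<star> f x)}"

definition direct_sum :: "'v set \<Rightarrow> 'v set \<Rightarrow> 'v set \<Rightarrow> bool" where
  "direct_sum V W C \<longleftrightarrow> subspace W \<and> subspace C \<and> W \<inter> C = {0} \<and> V = {w + c |w c. w \<in> W \<and> c \<in> C}"

abbreviation line :: "'v \<Rightarrow> 'v set" where "line v \<equiv> range (\<lambda>c. c \<star> v)"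

lemma has_dim_subspace: "has_dim V n \<Longrightarrow> subspace V"
  by (simp add: has_dim_def)

lemma has_dim_finite: "has_dim V n \<Longrightarrow> finite V"
  using q_ge_2 by (intro card_ge_0_finite) (auto simp: has_dim_def)

lemma has_dim_card: "has_dim V n \<Longrightarrow> card V = q ^ n"
  by (simp add: has_dim_def)

lemma has_dim_unique: "has_dim V n \<Longrightarrow> has_dim V m \<Longrightarrow> n = m"
  using q_ge_2 by (auto simp: has_dim_def)

lemma has_dim_mono: "has_dim V n \<Longrightarrow> has_dim W m \<Longrightarrow> W \<subseteq> V \<Longrightarrow> m \<le> n"
  using q_ge_2 card_mono[of V W] has_dim_finite[of V n] by (auto simp: has_dim_def)

lemma has_dim_eq: "has_dim V n \<Longrightarrow> has_dim W n \<Longrightarrow> W \<subseteq> V \<Longrightarrow> W = V"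
  by (metis card_subset_eq has_dim_card has_dim_finite)

lemma has_dim_0: "has_dim V 0 \<longleftrightarrow> V = {0}"
proof
  assume "has_dim V 0"
  then obtain x where "V = {x}" by (auto simp: has_dim_def card_1_singleton_iff)
  moreover have "0 \<in> V" using \<open>has_dim V 0\<close> has_dim_subspace subspace_0 by blast
  ultimately show "V = {0}" by simp
qed (simp add: has_dim_def)

lemma subspace_line [simp]: "subspace (line v)"
  using span_singleton[of v] by (metis subspace_span)

lemma line_self [simp]: "v \<in> line v"
  by (rule image_eqI[of _ _ 1]) auto

lemma has_dim_line: "v \<noteq> 0 \<Longrightarrow> has_dim (line v) 1"
  by (auto simp: has_dim_def card_image inj_on_def q_card[symmetric])

lemma direct_sum_subspace: "direct_sum V W C \<Longrightarrow> subspace V"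
  using subspace_sums[of W C] by (auto simp: direct_sum_def)

lemma direct_sum_sub: assumes "direct_sum V W C" shows "W \<subseteq> V" "C \<subseteq> V" "subspace W" "subspace C"
proof -
  have "w \<in> V" if "w \<in> W" for w
    using assms that subspace_0[of C] by (force simp: direct_sum_def)
  moreover have "w \<in> V" if "w \<in> C" for w
    using assms that subspace_0[of W] by (force simp: direct_sum_def)
  ultimately show "W \<subseteq> V" "C \<subseteq> V" by auto
qed (use assms in \<open>auto simp: direct_sum_def\<close>)

lemma direct_sumE:
  assumes "direct_sum V W C" "v \<in> V"
  obtains w c where "w \<in> W" "c \<in> C" "v = w + c"
  using assms by (auto simp: direct_sum_def)

lemma direct_sum_unique:
  assumes "direct_sum V W C" "w \<in> W" "c \<in> C" "w' \<in> W" "c' \<in> C" "w + c = w' + c'"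
  shows "w = w' \<and> c = c'"
proof -
  have "w - w' = c' - c" using assms(6) by (simp add: algebra_simps)
  moreover have "w - w' \<in> W" "c' - c \<in> C" using assms by (auto simp: direct_sum_def intro: subspace_diff)
  ultimately have "w - w' \<in> W \<inter> C" by auto
  moreover have "W \<inter> C = {0}" using assms(1) by (simp add: direct_sum_def)
  ultimately have "w - w' = 0" by blast
  thus ?thesis using assms(6) by simp
qed

lemma direct_sum_card: assumes "direct_sum V W C" shows "card V = card W * card C"
proof -
  have "V = (\<lambda>(w, c). w + c) ` (W \<times> C)" using assms by (auto simp: direct_sum_def)
  moreover have "inj_on (\<lambda>(w, c). w + c) (W \<times> C)"
    using direct_sum_unique[OF assms] by (auto simp: inj_on_def)
  ultimately show ?thesis by (simp add: card_image card_cartesian_product)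
qed

lemma direct_sum_has_dim: "direct_sum V W C \<Longrightarrow> has_dim W m \<Longrightarrow> has_dim C k \<Longrightarrow> has_dim V (m + k)"
  by (auto simp: has_dim_def direct_sum_card direct_sum_subspace power_add)

lemma direct_sum_line:
  assumes "subspace U" "v \<notin> U"
  shows "direct_sum {u + c |u c. u \<in> U \<and> c \<in> line v} U (line v)"
proof -
  have "c = 0" if "c \<star> v \<in> U" for c
  proof (rule ccontr)
    assume "c \<noteq> 0"
    hence "v = inverse c \<star> (c \<star> v)" by simp
    hence "v \<in> U" using subspace_scale[OF assms(1) that] by metis
    thus False using assms by simp
  qed
  hence "U \<inter> line v = {0}" using subspace_0[OF assms(1)] by (force intro: image_eqI[of _ _ 0])
  thus ?thesis using assms by (auto simp: direct_sum_def)
qed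

text \<open>A maximal subspace meeting \<open>W\<close> trivially works: a vector outside its sum
  with \<open>W\<close> could be adjoined to it without creating an intersection with
  \<open>W\<close>.\<close>

lemma complement_exists:
  assumes V: "subspace V" "finite V" and W: "subspace W" "W \<subseteq> V"
  obtains C where "direct_sum V W C"
proof -
  define S where "S = {C. subspace C \<and> C \<subseteq> V \<and> W \<inter> C = {0}}"
  have "S \<subseteq> Pow V" by (auto simp: S_def)
  hence "finite S" using V by (simp add: finite_subset)
  moreover have "{0} \<in> S" using V W subspace_0 by (auto simp: S_def)
  ultimately obtain C where C: "C \<in> S" "\<And>D. D \<in> S \<Longrightarrow> C \<subseteq> D \<Longrightarrow> C = D"
    using finite_has_maximal[of S] by blast
  have sC: "subspace C" "C \<subseteq> V" "W \<inter> C = {0}" using C(1) by (auto simp: S_def)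
  have d: "direct_sum {w + c |w c. w \<in> W \<and> c \<in> C} W C" using sC W by (simp add: direct_sum_def)
  have "V \<subseteq> {w + c |w c. w \<in> W \<and> c \<in> C}"
  proof (rule ccontr)
    assume "\<not> ?thesis"
    then obtain v where v: "v \<in> V" "v \<notin> {w + c |w c. w \<in> W \<and> c \<in> C}" by blast
    let ?D = "{u + c |u c. u \<in> C \<and> c \<in> line v}"
    have vC: "v \<notin> C" using v direct_sum_sub[OF d] by blast
    have dl: "direct_sum ?D C (line v)" using direct_sum_line[OF sC(1) vC] .
    note dl2 = direct_sum_line[OF direct_sum_subspace[OF d] v(2)]
    have "W \<inter> ?D \<subseteq> {0}"
    proof
      fix x assume "x \<in> W \<inter> ?D"
      then obtain u c where x: "x \<in> W" "u \<in> C" "x = u + c \<star> v" by auto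
      \<comment> \<open>\<open>x - u\<close> lies in \<open>W + C\<close> and is a multiple of
        \<open>v\<close>; the sum of \<open>W + C\<close> and the line of \<open>v\<close> is
        direct, so it is 0.\<close>
      have "x + (-u) = 0 + c \<star> v" using x by simp
      moreover have "0 \<in> {w + c |w c. w \<in> W \<and> c \<in> C}" using direct_sum_subspace[OF d] subspace_0 by blast
      moreover have "x + (-u) \<in> {w + c |w c. w \<in> W \<and> c \<in> C}" using x sC subspace_neg by blast
      moreover have "0 \<in> line v" by (rule image_eqI[of _ _ 0]) auto
      ultimately have "x + (-u) = 0 \<and> 0 = c \<star> v"
        using direct_sum_unique[OF dl2, of "x + (-u)" 0 0 "c \<star> v"] by (metis add.right_neutral rangeI)
      hence "x + (-u) = 0" ..
      hence "x = u" by simp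
      hence "x \<in> W \<inter> C" using x by blast
      thus "x \<in> {0}" using sC by simp
    qed
    moreover have "?D \<subseteq> V" using v V sC by (auto intro!: subspace_add subspace_scale)
    ultimately have "?D \<in> S" using direct_sum_subspace[OF dl] W subspace_0 by (force simp: S_def)
    moreover have "C \<subseteq> ?D" using direct_sum_sub[OF dl] by simp
    ultimately have "C = ?D" using C by blast
    moreover have "v \<in> ?D" using direct_sum_sub(2)[OF dl] line_self by blast
    ultimately show False using vC by simp
  qed
  moreover have "{w + c |w c. w \<in> W \<and> c \<in> C} \<subseteq> V" using V W sC by (auto intro!: subspace_add)
  ultimately have e: "{w + c |w c. w \<in> W \<and> c \<in> C} = V" by (metis (lifting) subset_antisym)
  have "direct_sum V W C" using d unfolding e .
  thus ?thesis using that by blast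
qed

text \<open>Splitting off a line divides the cardinality by \<open>q\<close>, so induction on
  \<open>card V\<close> shows that it is a power of \<open>q\<close>.\<close>

lemma has_dim_exists:
  assumes "subspace V" "finite V"
  obtains n where "has_dim V n"
proof -
  have "\<exists>n. has_dim V n" using assms
  proof (induction "card V" arbitrary: V rule: less_induct)
    case less
    show ?case
    proof (cases "V = {0}")
      case True thus ?thesis using has_dim_0 by blast
    next
      case False
      then obtain v where v: "v \<in> V" "v \<noteq> 0" using less.prems subspace_0 by blast
      have "line v \<subseteq> V" using v less.prems subspace_scale by blast
      then obtain C where C: "direct_sum V (line v) C" using complement_exists[of V "line v"] less.prems by auto
      have cC: "C \<subseteq> V" "subspace C" using direct_sum_sub[OF C] by auto
      have fC: "finite C" using cC less.prems finite_subset by blast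
      have "card C > 0" using subspace_0 cC fC by (auto simp: card_gt_0_iff)
      hence "card C < card V" using direct_sum_card[OF C] has_dim_card[OF has_dim_line[OF v(2)]] q_ge_2 by simp
      then obtain k where "has_dim C k" using less.hyps[of C] cC fC by blast
      thus ?thesis using direct_sum_has_dim[OF C has_dim_line[OF v(2)]] by blast
    qed
  qed
  thus ?thesis using that by blast
qed

lemma complement_has_dim:
  assumes "has_dim V n" "has_dim W m" "W \<subseteq> V"
  obtains C where "direct_sum V W C" "has_dim C (n - m)"
proof -
  obtain C where C: "direct_sum V W C" using complement_exists assms has_dim_subspace has_dim_finite by metis
  obtain k where k: "has_dim C k"
    using has_dim_exists[of C] direct_sum_sub[OF C] has_dim_finite[OF assms(1)] finite_subset by metis
  have "n = m + k" using has_dim_unique[OF assms(1) direct_sum_has_dim[OF C assms(2) k]] .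
  thus ?thesis using that C k by auto
qed

lemma has_dim_Suc:
  assumes "has_dim V (Suc n)"
  obtains v C where "v \<noteq> 0" "direct_sum V (line v) C" "has_dim C n"
proof -
  have "V \<noteq> {0}" using assms has_dim_0 has_dim_unique by (metis nat.distinct(1))
  then obtain v where v: "v \<in> V" "v \<noteq> 0" using assms has_dim_subspace subspace_0 by blast
  have "line v \<subseteq> V" using v assms subspace_scale has_dim_subspace by blast
  then obtain C where "direct_sum V (line v) C" "has_dim C (Suc n - 1)"
    using complement_has_dim[OF assms has_dim_line[OF v(2)]] by blast
  thus ?thesis using that v by auto
qed

section \<open>Linear maps on a subspace: kernels, fibres and rank-nullity\<close>

lemma linI:
  assumes "\<And>x. x \<in> V \<Longrightarrow> f x \<in> U" "\<And>x. x \<notin> V \<Longrightarrow> f x = undefined"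
    "\<And>x y. x \<in> V \<Longrightarrow> y \<in> V \<Longrightarrow> f (x + y) = f x + f y"
    "\<And>c x. x \<in> V \<Longrightarrow> f (c \<star> x) = c \<star> f x"
  shows "f \<in> lin_maps V U"
  using assms by (auto simp: lin_maps_def PiE_def extensional_def)

lemma
  assumes "f \<in> lin_maps V U"
  shows lin_in: "x \<in> V \<Longrightarrow> f x \<in> U" and lin_out: "x \<notin> V \<Longrightarrow> f x = undefined"
    and lin_add: "x \<in> V \<Longrightarrow> y \<in> V \<Longrightarrow> f (x + y) = f x + f y"
    and lin_scale: "x \<in> V \<Longrightarrow> f (c \<star> x) = c \<star> f x"
  using assms by (auto simp: lin_maps_def PiE_def extensional_def)

lemma lin_zero: "f \<in> lin_maps V U \<Longrightarrow> subspace V \<Longrightarrow> f 0 = 0"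
  using lin_scale[of f V U 0 0] subspace_0 by auto

lemma lin_diff: "f \<in> lin_maps V U \<Longrightarrow> subspace V \<Longrightarrow> x \<in> V \<Longrightarrow> y \<in> V \<Longrightarrow> f (x - y) = f x - f y"
  using lin_add[of f V U "x - y" y] by (simp add: subspace_diff)

lemma lin_eqI:
  assumes "f \<in> lin_maps V U" "g \<in> lin_maps V U'" "\<And>x. x \<in> V \<Longrightarrow> f x = g x"
  shows "f = g"
  using assms lin_out by (metis ext)

lemma lin_restrict: "f \<in> lin_maps V U \<Longrightarrow> W \<subseteq> V \<Longrightarrow> subspace W \<Longrightarrow> restrict f W \<in> lin_maps W U"
  by (rule linI) (auto simp: lin_in lin_add lin_scale subspace_add subspace_scale subset_iff)

lemma lin_codomain: "f \<in> lin_maps V U \<Longrightarrow> (\<And>x. x \<in> V \<Longrightarrow> f x \<in> U') \<Longrightarrow> f \<in> lin_maps V U'"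
  by (auto simp: lin_maps_def)

lemma lin_mono: "f \<in> lin_maps V U \<Longrightarrow> U \<subseteq> U' \<Longrightarrow> f \<in> lin_maps V U'"
  by (auto simp: lin_maps_def)

lemma lin_finite: "finite V \<Longrightarrow> finite U \<Longrightarrow> finite (lin_maps V U)"
  by (rule finite_subset[of _ "V \<rightarrow>\<^sub>E U"]) (auto simp: lin_maps_def intro: finite_PiE)

lemma lin_image_subspace:
  assumes "f \<in> lin_maps V U" "subspace V"
  shows "subspace (f ` V)"
  unfolding subspace_def
proof (intro conjI ballI allI)
  show "0 \<in> f ` V" using lin_zero[OF assms] subspace_0[OF assms(2)] by (metis imageI)
  fix x y assume "x \<in> f ` V" "y \<in> f ` V"
  then obtain u v where "u \<in> V" "v \<in> V" "x = f u" "y = f v" by blast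
  thus "x + y \<in> f ` V" using lin_add[OF assms(1)] subspace_add[OF assms(2)] by (metis imageI)
next
  fix c x assume "x \<in> f ` V"
  then obtain u where "u \<in> V" "x = f u" by blast
  thus "c \<star> x \<in> f ` V" using lin_scale[OF assms(1)] subspace_scale[OF assms(2)] by (metis imageI)
qed

lemma lin_ker_subspace:
  assumes "f \<in> lin_maps V U" "subspace V"
  shows "subspace {v\<in>V. f v = 0}"
  using assms by (auto simp: subspace_def lin_add lin_scale intro: lin_zero)

lemma lin_fiber:
  assumes "f \<in> lin_maps V U" "subspace V" "u \<in> f ` V"
  shows "card {v\<in>V. f v = u} = card {v\<in>V. f v = 0}"
proof -
  obtain w where w: "w \<in> V" "u = f w" using assms by auto
  have "bij_betw (\<lambda>v. v + w) {v\<in>V. f v = 0} {v\<in>V. f v = u}"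
    by (rule bij_betwI[where g = "\<lambda>v. v - w"])
       (use w assms in \<open>auto simp: lin_add lin_diff subspace_add subspace_diff\<close>)
  thus ?thesis by (simp add: bij_betw_same_card)
qed

lemma card_by_fibers:
  assumes "finite A" "\<And>y. y \<in> f ` A \<Longrightarrow> card {x\<in>A. f x = y} = k"
  shows "card A = card (f ` A) * k"
proof -
  have "card A = (\<Sum>y\<in>f ` A. card {x\<in>A. f x = y})"
    using sum.group[of A "f ` A" f "\<lambda>_. 1 :: nat"] assms(1) by simp
  thus ?thesis using assms by simp
qed

lemma rank_nullity:
  assumes "f \<in> lin_maps V U" "subspace V" "finite V"
  shows "card V = card (f ` V) * card {v\<in>V. f v = 0}"
  by (rule card_by_fibers) (use lin_fiber[OF assms(1,2)] assms in auto)

section \<open>Linear maps prescribed on the summands of a direct sum\<close>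

lemma lin_glue:
  assumes d: "direct_sum V W C" and g: "g \<in> lin_maps W U" and h: "h \<in> lin_maps C U" and U: "subspace U"
  obtains f where "f \<in> lin_maps V U" "\<And>x. x \<in> W \<Longrightarrow> f x = g x" "\<And>x. x \<in> C \<Longrightarrow> f x = h x"
proof -
  note s = direct_sum_sub[OF d]
  \<comment> \<open>One decomposition is chosen for each vector; uniqueness of decompositions is
    what makes the glued map linear.\<close>
  define P where "P v p \<longleftrightarrow> fst p \<in> W \<and> snd p \<in> C \<and> v = fst p + snd p" for v and p :: "'v \<times> 'v"
  have "\<forall>v. \<exists>p. v \<in> V \<longrightarrow> P v p" using direct_sumE[OF d] by (metis P_def fst_conv snd_conv)
  then obtain p where p: "\<And>v. v \<in> V \<Longrightarrow> P v (p v)" by metis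
  have pe: "fst (p (w + c)) = w" "snd (p (w + c)) = c" if "w \<in> W" "c \<in> C" for w c
  proof -
    have "w + c \<in> V" using that d by (auto simp: direct_sum_def)
    hence "P (w + c) (p (w + c))" using p by blast
    hence "w = fst (p (w + c)) \<and> c = snd (p (w + c))"
      using direct_sum_unique[OF d that, of "fst (p (w + c))" "snd (p (w + c))"] unfolding P_def by blast
    thus "fst (p (w + c)) = w" "snd (p (w + c)) = c" by simp_all
  qed
  define f where "f = (\<lambda>v\<in>V. g (fst (p v)) + h (snd (p v)))"
  have fe: "f (w + c) = g w + h c" if "w \<in> W" "c \<in> C" for w c
    using that pe[OF that] d by (auto simp: f_def direct_sum_def)
  have "f \<in> lin_maps V U"
  proof (rule linI)
    fix x assume "x \<in> V" thus "f x \<in> U"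
      using fe lin_in[OF g] lin_in[OF h] subspace_add[OF U] direct_sumE[OF d] by metis
  next
    fix x y assume "x \<in> V" "y \<in> V"
    then obtain w c w' c' where *: "w \<in> W" "c \<in> C" "x = w + c" "w' \<in> W" "c' \<in> C" "y = w' + c'"
      using direct_sumE[OF d] by metis
    have "x + y = (w + w') + (c + c')" using * by (simp add: algebra_simps)
    moreover have "f ((w + w') + (c + c')) = g (w + w') + h (c + c')"
      by (rule fe) (use * s in \<open>auto intro: subspace_add\<close>)
    ultimately have "f (x + y) = g (w + w') + h (c + c')" by simp
    also have "\<dots> = (g w + h c) + (g w' + h c')"
      using * lin_add[OF g] lin_add[OF h] by (simp add: algebra_simps)
    also have "\<dots> = f x + f y" using * fe by simp
    finally show "f (x + y) = f x + f y" .
  next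
    fix a x assume "x \<in> V"
    then obtain w c where *: "w \<in> W" "c \<in> C" "x = w + c" using direct_sumE[OF d] by metis
    have "a \<star> x = a \<star> w + a \<star> c" using * by (simp add: scale_right_distrib)
    moreover have "f (a \<star> w + a \<star> c) = g (a \<star> w) + h (a \<star> c)"
      by (rule fe) (use * s in \<open>auto intro: subspace_scale\<close>)
    ultimately show "f (a \<star> x) = a \<star> f x" using * fe[of w c] lin_scale[OF g] lin_scale[OF h] by (simp add: scale_right_distrib)
  qed (simp add: f_def)
  moreover have "f x = g x" if "x \<in> W" for x
    using fe[OF that, of 0] lin_zero[OF h] s subspace_0 by simp
  moreover have "f x = h x" if "x \<in> C" for x
    using fe[OF _ that, of 0] lin_zero[OF g] s subspace_0 by simp
  ultimately show ?thesis using that by blast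
qed

lemma lin_direct_sum_eqI:
  assumes d: "direct_sum V W C" "f \<in> lin_maps V U" "g \<in> lin_maps V U'"
    "\<And>x. x \<in> W \<Longrightarrow> f x = g x" "\<And>x. x \<in> C \<Longrightarrow> f x = g x"
  shows "f = g"
proof (rule lin_eqI[OF assms(2,3)])
  fix x assume "x \<in> V"
  then obtain w c where "w \<in> W" "c \<in> C" "x = w + c" using direct_sumE[OF d(1)] by metis
  thus "f x = g x" using assms direct_sum_sub[OF d(1)] lin_add[OF d(2)] lin_add[OF d(3)] by (metis subsetD)
qed

lemma lin_split:
  assumes d: "direct_sum V W C" and U: "subspace U"
  shows "bij_betw (\<lambda>f. (restrict f W, restrict f C)) (lin_maps V U) (lin_maps W U \<times> lin_maps C U)"
  unfolding bij_betw_def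
proof
  note s = direct_sum_sub[OF d]
  show "inj_on (\<lambda>f. (restrict f W, restrict f C)) (lin_maps V U)"
  proof (rule inj_onI)
    fix f g assume f: "f \<in> lin_maps V U" "g \<in> lin_maps V U"
      and e: "(restrict f W, restrict f C) = (restrict g W, restrict g C)"
    have "f x = g x" if "x \<in> W" for x using e that by (metis Pair_inject restrict_apply')
    moreover have "f x = g x" if "x \<in> C" for x using e that by (metis Pair_inject restrict_apply')
    ultimately show "f = g" by (rule lin_direct_sum_eqI[OF d f])
  qed
  show "(\<lambda>f. (restrict f W, restrict f C)) ` lin_maps V U = lin_maps W U \<times> lin_maps C U"
  proof (intro equalityI subsetI)
    fix p assume "p \<in> lin_maps W U \<times> lin_maps C U"
    then obtain g h where p: "p = (g, h)" "g \<in> lin_maps W U" "h \<in> lin_maps C U" by auto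
    from lin_glue[OF d p(2,3) U] obtain f where
      f: "f \<in> lin_maps V U" "\<And>x. x \<in> W \<Longrightarrow> f x = g x" "\<And>x. x \<in> C \<Longrightarrow> f x = h x" by blast
    have "restrict f W = g" by (rule lin_eqI[OF lin_restrict[OF f(1) s(1,3)] p(2)]) (use f in auto)
    moreover have "restrict f C = h" by (rule lin_eqI[OF lin_restrict[OF f(1) s(2,4)] p(3)]) (use f in auto)
    ultimately show "p \<in> (\<lambda>f. (restrict f W, restrict f C)) ` lin_maps V U" using p f by (intro image_eqI[of _ _ f]) auto
  qed (use s lin_restrict in auto)
qed

text \<open>The transfer used for counts over a direct sum: a condition expressed through the two
  restrictions turns the count into one over pairs.\<close>

lemma card_lin_split:
  assumes "direct_sum V W C" "subspace U"
    "\<And>f. f \<in> lin_maps V U \<Longrightarrow> P f \<longleftrightarrow> Q (restrict f W) (restrict f C)"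
  shows "card {f \<in> lin_maps V U. P f} = card {p \<in> lin_maps W U \<times> lin_maps C U. Q (fst p) (snd p)}"
proof -
  note b = lin_split[OF assms(1,2)]
  have "bij_betw (\<lambda>f. (restrict f W, restrict f C)) {f \<in> lin_maps V U. P f} {p \<in> lin_maps W U \<times> lin_maps C U. Q (fst p) (snd p)}"
by (rule bij_betw_Collect[OF b]) (use assms(3) in auto)
  thus ?thesis by (rule bij_betw_same_card)
qed

lemma lin_line:
  assumes "v \<noteq> 0" "subspace U"
  shows "bij_betw (\<lambda>f. f v) (lin_maps (line v) U) U"
  unfolding bij_betw_def
proof
  have vl: "v \<in> line v" by simp
  show "inj_on (\<lambda>f. f v) (lin_maps (line v) U)"
  proof (rule inj_onI)
    fix f g assume "f \<in> lin_maps (line v) U" "g \<in> lin_maps (line v) U" "f v = g v"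
    thus "f = g" by (intro lin_eqI[of f "line v" U g U]) (auto simp: lin_scale[OF _ vl])
  qed
  show "(\<lambda>f. f v) ` lin_maps (line v) U = U"
  proof (intro equalityI subsetI)
    fix u assume u: "u \<in> U"
    \<comment> \<open>The coefficient is recovered by choice; it is unique because
      \<open>v \<noteq> 0\<close>.\<close>
    define f where "f = (\<lambda>x\<in>line v. (SOME c. x = c \<star> v) \<star> u)"
    have f: "f (c \<star> v) = c \<star> u" for c
    proof -
      have "c \<star> v = (SOME d. c \<star> v = d \<star> v) \<star> v" by (rule someI[of _ c]) simp
      hence "(SOME d. c \<star> v = d \<star> v) = c" using assms(1) by simp
      moreover have "f (c \<star> v) = (SOME d. c \<star> v = d \<star> v) \<star> u"
        unfolding f_def by (rule restrict_apply'[OF rangeI])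
      ultimately show ?thesis by metis
    qed
    have "f \<in> lin_maps (line v) U"
    proof (rule linI)
      fix x y assume "x \<in> line v" "y \<in> line v"
      then obtain a b where ab: "x = a \<star> v" "y = b \<star> v" by blast
      show "f (x + y) = f x + f y" using f[of a] f[of b] f[of "a + b"] ab by (simp add: scale_left_distrib)
    next
      fix a x assume "x \<in> line v"
      then obtain b where "x = b \<star> v" by blast
      thus "f (a \<star> x) = a \<star> f x" using f[of b] f[of "a * b"] by simp
    next
      fix x assume "x \<in> line v"
      then obtain b where "x = b \<star> v" by blast
      thus "f x \<in> U" using f[of b] subspace_scale[OF assms(2) u] by simp
    qed (simp add: f_def)
    thus "u \<in> (\<lambda>f. f v) ` lin_maps (line v) U" using f[of 1] by (intro image_eqI[of _ _ f]) auto
  qed (auto intro: lin_in vl)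
qed

section \<open>Counting linear maps and subspaces\<close>

lemma direct_sum_add: "direct_sum V W C \<Longrightarrow> w \<in> W \<Longrightarrow> c \<in> C \<Longrightarrow> w + c \<in> V"
  by (auto simp: direct_sum_def)

lemma lin_from_zero: "0 \<in> U \<Longrightarrow> lin_maps {0} U = {\<lambda>x\<in>{0}. 0}"
proof (intro equalityI subsetI)
  fix f assume "f \<in> lin_maps {0} U"
  moreover from this have "f 0 = 0" by (rule lin_zero) simp
  ultimately have "f = (\<lambda>x\<in>{0}. 0)" by (auto simp: fun_eq_iff lin_out)
  thus "f \<in> {\<lambda>x\<in>{0}. 0}" by simp
next
  fix f :: "'v \<Rightarrow> 'v" assume "0 \<in> U" "f \<in> {\<lambda>x\<in>{0}. 0}"
  thus "f \<in> lin_maps {0} U" by (intro linI) auto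
qed

lemma direct_sum_line_apply:
  assumes "direct_sum V (line v) C" "f \<in> lin_maps V U" "c \<in> C"
  shows "f (a \<star> v + c) = a \<star> f v + f c"
proof -
  note s = direct_sum_sub[OF assms(1)]
  have "v \<in> V" using s(1) line_self by blast
  moreover have "a \<star> v \<in> V" using s(1) by blast
  ultimately show ?thesis using lin_add[OF assms(2)] lin_scale[OF assms(2)] assms(3) s(2) by (metis subsetD)
qed

text \<open>The engine of the inductions on dimension: the image of one basis vector ranges over
  \<open>U\<close>, and the rest is a map on a complement of one dimension less.\<close>

lemma card_lin_line_split:
  assumes d: "direct_sum V (line v) C" and v: "v \<noteq> 0" and U: "subspace U" "finite U" and C: "finite C"
    and PQ: "\<And>f. f \<in> lin_maps V U \<Longrightarrow> P f \<longleftrightarrow> Q (f v) (restrict f C)"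
  shows "card {f \<in> lin_maps V U. P f} = (\<Sum>x\<in>U. card {g \<in> lin_maps C U. Q x g})"
proof -
  have "card {f \<in> lin_maps V U. P f} = card {p \<in> lin_maps (line v) U \<times> lin_maps C U. Q (fst p v) (snd p)}"
    by (rule card_lin_split[OF d U(1)]) (subst restrict_apply'[OF line_self], erule PQ)
  also have "\<dots> = card {p \<in> U \<times> lin_maps C U. Q (fst p) (snd p)}"
  proof (rule bij_betw_same_card, rule bij_betw_Collect)
    show "bij_betw (map_prod (\<lambda>f. f v) id) (lin_maps (line v) U \<times> lin_maps C U) (U \<times> lin_maps C U)"
      by (rule bij_betw_map_prod) (auto intro: lin_line[OF v U(1)])
  qed auto
  also have "{p \<in> U \<times> lin_maps C U. Q (fst p) (snd p)} = (SIGMA x:U. {g \<in> lin_maps C U. Q x g})" by auto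
  also have "card \<dots> = (\<Sum>x\<in>U. card {g \<in> lin_maps C U. Q x g})"
    by (rule card_SigmaI) (use U C lin_finite in auto)
  finally show ?thesis .
qed

text \<open>Each basis vector of \<open>C\<close> may be sent anywhere in one fibre of
  \<open>A\<close>; as \<open>A\<close> maps onto \<open>W\<close>, every such fibre is a coset of
  its kernel.\<close>

lemma card_lifts:
  assumes A: "A \<in> lin_maps V W" "A ` V = W" and V: "subspace V" "finite V"
    and C: "has_dim C m" and h: "h \<in> lin_maps C W"
  shows "card {f \<in> lin_maps C V. \<forall>c\<in>C. A (f c) = h c} = card {x\<in>V. A x = 0} ^ m"
  using C h
proof (induction m arbitrary: C h)
  case 0
  hence "C = {0}" by (simp add: has_dim_0)
  moreover have "0 \<in> V" using V subspace_0 by blast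
  moreover have "h 0 = 0" using 0 lin_zero has_dim_subspace by blast
  moreover have "A 0 = 0" using A(1) V lin_zero by blast
  ultimately show ?case by (simp add: lin_from_zero conj_commute cong: conj_cong)
next
  case (Suc m)
  obtain v D where v: "v \<noteq> 0" and d: "direct_sum C (line v) D" and D: "has_dim D m"
    using has_dim_Suc[OF Suc.prems(1)] .
  note s = direct_sum_sub[OF d]
  have vC: "v \<in> C" using s(1) line_self by blast
  define Q where "Q x g \<longleftrightarrow> A x = h v \<and> (\<forall>c\<in>D. A (g c) = restrict h D c)" for x g
  have "card {f \<in> lin_maps C V. \<forall>c\<in>C. A (f c) = h c} = (\<Sum>x\<in>V. card {g \<in> lin_maps D V. Q x g})"
  proof (rule card_lin_line_split[OF d v V has_dim_finite[OF D]])
    fix f assume f: "f \<in> lin_maps C V"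
    show "(\<forall>c\<in>C. A (f c) = h c) \<longleftrightarrow> Q (f v) (restrict f D)"
    proof
      assume "\<forall>c\<in>C. A (f c) = h c"
      thus "Q (f v) (restrict f D)" using vC s(2) by (auto simp: Q_def)
    next
      assume q: "Q (f v) (restrict f D)"
      show "\<forall>c\<in>C. A (f c) = h c"
      proof
        fix c assume "c \<in> C"
        then obtain a e where ae: "e \<in> D" "c = a \<star> v + e" using direct_sumE[OF d] by (metis imageE)
        have "A (f c) = A (a \<star> f v + f e)" using direct_sum_line_apply[OF d f ae(1)] ae by simp
        also have "\<dots> = a \<star> A (f v) + A (f e)"
          using ae s(2) vC lin_in[OF f] lin_add[OF A(1)] lin_scale[OF A(1)] subspace_scale[OF V(1)] by (metis subsetD)
        also have "\<dots> = a \<star> h v + h e" using q ae by (simp add: Q_def)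
        also have "\<dots> = h c" using direct_sum_line_apply[OF d Suc.prems(2) ae(1)] ae by simp
        finally show "A (f c) = h c" .
      qed
    qed
  qed
  also have "\<dots> = (\<Sum>x\<in>V. if A x = h v then card {x\<in>V. A x = 0} ^ m else 0)"
    using Suc.IH[OF D lin_restrict[OF Suc.prems(2) s(2,4)]]
    by (intro sum.cong) (auto simp: Q_def)
  also have "\<dots> = card {x\<in>V. A x = h v} * card {x\<in>V. A x = 0} ^ m"
    using V by (simp add: sum.If_cases Int_def)
  also have "card {x\<in>V. A x = h v} = card {x\<in>V. A x = 0}"
    using lin_fiber[OF A(1) V(1)] A(2) lin_in[OF Suc.prems(2) vC] by blast
  finally show ?case by simp
qed

text \<open>The number of independent \<open>d\<close>-tuples in dimension \<open>n\<close>: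
  injections from dimension \<open>d\<close> into dimension \<open>n\<close> and, by transposition,
  surjections from dimension \<open>n\<close> onto dimension \<open>d\<close>. In particular
  \<open>frames n n\<close> is |GL(n,q)|. Real values avoid truncated subtraction; for
  \<open>d > n\<close> the factor \<open>j = n\<close> is 0.\<close>

definition frames :: "nat \<Rightarrow> nat \<Rightarrow> real" where
  "frames n d = (\<Prod>j<d. real q ^ n - real q ^ j)"

text \<open>Extracting the factor \<open>j = 0\<close> and one \<open>q\<close> from each other
  factor makes everything a multiple of \<open>frames m d\<close>; then (q^(m+1) - 1) q^d = (q^m -
  q^d) + (q^(d+1) - 1) q^m.\<close>

lemma frames_Suc: "frames (Suc m) (Suc d) = frames m (Suc d) + (real q ^ Suc d - 1) * real q ^ m * frames m d"
proof -
  have "frames (Suc m) (Suc d) = (real q ^ Suc m - 1) * (\<Prod>j<d. real q ^ Suc m - real q ^ Suc j)"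
    unfolding frames_def by (subst prod.lessThan_Suc_shift) simp
  also have "(\<Prod>j<d. real q ^ Suc m - real q ^ Suc j) = (\<Prod>j<d. real q * (real q ^ m - real q ^ j))"
    by (simp add: algebra_simps)
  also have "\<dots> = real q ^ d * frames m d" by (simp add: prod.distrib frames_def)
  finally have "frames (Suc m) (Suc d) = (real q ^ Suc m - 1) * real q ^ d * frames m d" by simp
  moreover have "frames m (Suc d) = frames m d * (real q ^ m - real q ^ d)" by (simp add: frames_def)
  ultimately show ?thesis by (simp add: algebra_simps power_add[symmetric])
qed

lemma frames_0_left: "frames 0 d = (if d = 0 then 1 else 0)"
  by (auto simp: frames_def intro!: prod_zero bexI[of _ 0])

lemma sums_line_absorb:
  assumes "subspace U" "x \<in> U"
  shows "{u + c |u c. u \<in> U \<and> c \<in> line x} = U"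
proof (intro equalityI subsetI)
  fix y assume "y \<in> U"
  thus "y \<in> {u + c |u c. u \<in> U \<and> c \<in> line x}"
    by (intro CollectI exI[of _ y] exI[of _ 0] conjI image_eqI[of _ _ 0]) auto
qed (use assms in \<open>auto intro!: subspace_add subspace_scale\<close>)

lemma sums_line_has_dim:
  assumes "has_dim U u" "x \<notin> U"
  shows "has_dim {u + c |u c. u \<in> U \<and> c \<in> line x} (Suc u)"
proof -
  have "x \<noteq> 0" using assms subspace_0 has_dim_subspace by blast
  thus ?thesis using direct_sum_has_dim[OF direct_sum_line[OF has_dim_subspace[OF assms(1)] assms(2)] assms(1) has_dim_line] by simp
qed

lemma sum_split_subspace:
  fixes a b :: real
  assumes "has_dim W r" "has_dim U u" "U \<subseteq> W"
  shows "(\<Sum>x\<in>W. if x \<in> U then a else b) = real q ^ u * a + (real q ^ r - real q ^ u) * b"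
proof -
  have f: "finite W" "finite U" using assms has_dim_finite by auto
  have "W \<inter> {x. x \<in> U} = U" "W \<inter> - {x. x \<in> U} = W - U" using assms by auto
  hence "(\<Sum>x\<in>W. if x \<in> U then a else b) = real (card U) * a + real (card (W - U)) * b"
    using f by (simp add: sum.If_cases)
  also have "real (card (W - U)) = real (card W) - real (card U)"
    using f assms by (simp add: card_Diff_subset of_nat_diff card_mono)
  finally show ?thesis using assms by (simp add: has_dim_card)
qed

text \<open>The maps counted here are the extensions to \<open>C\<close> that make up, together with a map whose image is
  \<open>U\<close>, a surjection onto \<open>W\<close>. Sending a first basis vector into or out of \<open>U\<close> gives the recursion
  \<open>frames_Suc\<close>.\<close>

lemma card_spanning:
  assumes W: "has_dim W r" and C: "has_dim C m" and U: "has_dim U u" "U \<subseteq> W"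
  shows "real (card {f \<in> lin_maps C W. W \<subseteq> {x + f c |x c. x \<in> U \<and> c \<in> C}}) = real q ^ (m * u) * frames m (r - u)"
  using C U
proof (induction m arbitrary: C U u)
  case 0
  hence C: "C = {0}" by (simp add: has_dim_0)
  have 1: "0 \<in> W" using W has_dim_subspace subspace_0 by blast
  have "u \<le> r" using has_dim_mono[OF W] 0 by blast
  moreover have "W \<subseteq> U \<longleftrightarrow> r = u"
    using has_dim_unique[OF W] has_dim_eq[OF W] 0 by (metis subset_antisym subset_refl)
  moreover have "{f \<in> lin_maps C W. W \<subseteq> {x + f c |x c. x \<in> U \<and> c \<in> C}} = (if W \<subseteq> U then {\<lambda>x\<in>{0}. 0} else {})"
    using lin_from_zero[OF 1] by (auto simp: C)
  ultimately show ?case by (simp add: frames_0_left)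
next
  case (Suc m)
  obtain v D where v: "v \<noteq> 0" and d: "direct_sum C (line v) D" and D: "has_dim D m"
    using has_dim_Suc[OF Suc.prems(1)] .
  note s = direct_sum_sub[OF d]
  \<comment> \<open>The part of \<open>W\<close> covered once the first basis vector is sent to
    \<open>x\<close>; it takes the place of \<open>U\<close> in the induction hypothesis.\<close>
  define Ux where "Ux x = {u + c |u c. u \<in> U \<and> c \<in> line x}" for x
  have ur: "u \<le> r" using has_dim_mono[OF W Suc.prems(2,3)] .
  note sU = has_dim_subspace[OF Suc.prems(2)] and sW = has_dim_subspace[OF W]
  define Q where "Q x g \<longleftrightarrow> W \<subseteq> {y + g c |y c. y \<in> Ux x \<and> c \<in> D}" for x g
  have "card {f \<in> lin_maps C W. W \<subseteq> {x + f c |x c. x \<in> U \<and> c \<in> C}} = (\<Sum>x\<in>W. card {g \<in> lin_maps D W. Q x g})"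
  proof (rule card_lin_line_split[OF d v sW has_dim_finite[OF W] has_dim_finite[OF D]])
    fix f assume f: "f \<in> lin_maps C W"
    have "{x + f c |x c. x \<in> U \<and> c \<in> C} = {y + restrict f D c |y c. y \<in> Ux (f v) \<and> c \<in> D}"
    proof (intro equalityI subsetI)
      fix z assume "z \<in> {x + f c |x c. x \<in> U \<and> c \<in> C}"
      then obtain x c where xc: "x \<in> U" "c \<in> C" "z = x + f c" by blast
      then obtain a e where ae: "e \<in> D" "c = a \<star> v + e" using direct_sumE[OF d] by (metis imageE)
      hence "z = (x + a \<star> f v) + restrict f D e" using direct_sum_line_apply[OF d f ae(1)] xc by (simp add: add.assoc)
      moreover have "x + a \<star> f v \<in> Ux (f v)" using xc by (auto simp: Ux_def)
      ultimately show "z \<in> {y + restrict f D c |y c. y \<in> Ux (f v) \<and> c \<in> D}" using ae by blast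
    next
      fix z assume "z \<in> {y + restrict f D c |y c. y \<in> Ux (f v) \<and> c \<in> D}"
      then obtain y e where ye: "y \<in> Ux (f v)" "e \<in> D" "z = y + f e" by auto
      then obtain x a where xa: "x \<in> U" "y = x + a \<star> f v" by (auto simp: Ux_def)
      have "z = x + f (a \<star> v + e)" using direct_sum_line_apply[OF d f ye(2)] ye xa by (simp add: add.assoc)
      moreover have "a \<star> v + e \<in> C" by (rule direct_sum_add[OF d rangeI ye(2)])
      ultimately show "z \<in> {x + f c |x c. x \<in> U \<and> c \<in> C}" using xa by blast
    qed
    thus "W \<subseteq> {x + f c |x c. x \<in> U \<and> c \<in> C} \<longleftrightarrow> Q (f v) (restrict f D)" by (simp only: Q_def)
  qed
  \<comment> \<open>A value inside \<open>U\<close> leaves the dimension \<open>u\<close>, a value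
    outside raises it to \<open>Suc u\<close>.\<close>
  also have "real \<dots> = (\<Sum>x\<in>W. if x \<in> U then real q ^ (m * u) * frames m (r - u)
       else real q ^ (m * Suc u) * frames m (r - Suc u))"
    unfolding of_nat_sum
  proof (intro sum.cong refl)
    fix x assume x: "x \<in> W"
    show "real (card {g \<in> lin_maps D W. Q x g}) = (if x \<in> U then real q ^ (m * u) * frames m (r - u)
       else real q ^ (m * Suc u) * frames m (r - Suc u))"
    proof (cases "x \<in> U")
      case True
      hence "Ux x = U" using sums_line_absorb[OF sU] by (simp add: Ux_def)
      thus ?thesis using Suc.IH[OF D Suc.prems(2,3)] True by (simp add: Q_def)
    next
      case False
      hence "has_dim (Ux x) (Suc u)" using sums_line_has_dim[OF Suc.prems(2)] by (simp add: Ux_def)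
      moreover have "Ux x \<subseteq> W" using x sW Suc.prems(3) by (auto simp: Ux_def intro!: subspace_add subspace_scale)
      ultimately show ?thesis using Suc.IH[OF D] False by (simp add: Q_def)
    qed
  qed
  also have "\<dots> = real q ^ u * (real q ^ (m * u) * frames m (r - u)) +
      (real q ^ r - real q ^ u) * (real q ^ (m * Suc u) * frames m (r - Suc u))"
    by (rule sum_split_subspace[OF W Suc.prems(2,3)])
  also have "\<dots> = real q ^ (Suc m * u) * frames (Suc m) (r - u)"
  proof (cases "r = u")
    \<comment> \<open>With \<open>r = u\<close> the factor q^r - q^u removes the term in which
      \<open>r - Suc u\<close> is truncated.\<close>
    case True thus ?thesis by (simp add: frames_def power_add)
  next
    case False
    then obtain e where e: "r = u + Suc e" using ur by (metis add_Suc_right le_neq_implies_less less_imp_Suc_add)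
    show ?thesis unfolding e by (simp add: frames_Suc algebra_simps power_add)
  qed
  finally show ?case .
qed

text \<open>Injectivity modulo \<open>U\<close> lets the induction absorb the image of the first
  basis vector into \<open>U\<close>: this image avoids q^u vectors, the next one q^(u+1), and so
  on.\<close>

lemma card_injective_mod:
  assumes V: "has_dim V n" and C: "has_dim C m" and U: "has_dim U u" "U \<subseteq> V"
  shows "real (card {f \<in> lin_maps C V. \<forall>c\<in>C. f c \<in> U \<longrightarrow> c = 0}) = (\<Prod>j<m. real q ^ n - real q ^ (u + j))"
  using C U
proof (induction m arbitrary: C U u)
  case 0
  hence C: "C = {0}" by (simp add: has_dim_0)
  have "0 \<in> V" using V has_dim_subspace subspace_0 by blast
  from lin_from_zero[OF this] show ?case by (auto simp: C)
next
  case (Suc m)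
  obtain v D where v: "v \<noteq> 0" and d: "direct_sum C (line v) D" and D: "has_dim D m"
    using has_dim_Suc[OF Suc.prems(1)] .
  note s = direct_sum_sub[OF d]
  have vC: "v \<in> C" using s(1) line_self by blast
  define Ux where "Ux x = {u + c |u c. u \<in> U \<and> c \<in> line x}" for x
  note sU = has_dim_subspace[OF Suc.prems(2)] and sV = has_dim_subspace[OF V]
  define Q where "Q x g \<longleftrightarrow> x \<notin> U \<and> (\<forall>c\<in>D. g c \<in> Ux x \<longrightarrow> c = 0)" for x g
  have "card {f \<in> lin_maps C V. \<forall>c\<in>C. f c \<in> U \<longrightarrow> c = 0} = (\<Sum>x\<in>V. card {g \<in> lin_maps D V. Q x g})"
  proof (rule card_lin_line_split[OF d v sV has_dim_finite[OF V] has_dim_finite[OF D]])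
    fix f assume f: "f \<in> lin_maps C V"
    show "(\<forall>c\<in>C. f c \<in> U \<longrightarrow> c = 0) \<longleftrightarrow> Q (f v) (restrict f D)"
    proof
      assume L: "\<forall>c\<in>C. f c \<in> U \<longrightarrow> c = 0"
      have "c = 0" if cD: "c \<in> D" "f c \<in> Ux (f v)" for c
      proof -
        obtain x a where xa: "x \<in> U" "f c = x + a \<star> f v" using cD(2) unfolding Ux_def by blast
        have "f ((- a) \<star> v + c) = x" using direct_sum_line_apply[OF d f cD(1), of "- a"] xa by simp
        moreover have "(- a) \<star> v + c \<in> C" by (rule direct_sum_add[OF d rangeI cD(1)])
        ultimately have "(- a) \<star> v + c = 0" using L xa by blast
        hence "c = a \<star> v" by simp
        hence "c \<in> line v \<inter> D" using cD by blast
        moreover have "line v \<inter> D = {0}" using d by (simp add: direct_sum_def)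
        ultimately show ?thesis by blast
      qed
      thus "Q (f v) (restrict f D)" using L v vC by (auto simp: Q_def)
    next
      assume R: "Q (f v) (restrict f D)"
      show "\<forall>c\<in>C. f c \<in> U \<longrightarrow> c = 0"
      proof (intro ballI impI)
        fix c assume c: "c \<in> C" "f c \<in> U"
        then obtain a e where ae: "e \<in> D" "c = a \<star> v + e" using direct_sumE[OF d] by (metis imageE)
        have fc: "f c = a \<star> f v + f e" using direct_sum_line_apply[OF d f ae(1)] ae by simp
        hence "f e = f c + (- a) \<star> f v" by simp
        hence "f e \<in> Ux (f v)" using c unfolding Ux_def by blast
        hence e0: "e = 0" using R ae by (auto simp: Q_def)
        hence "f e = 0" using lin_zero[OF f] direct_sum_subspace[OF d] by simp
        hence afv: "a \<star> f v \<in> U" using fc c by simp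
        have "a = 0"
        proof (rule ccontr)
          assume a: "a \<noteq> 0"
          have "inverse a \<star> (a \<star> f v) \<in> U" using afv by (rule subspace_scale[OF sU])
          thus False using a R by (simp add: Q_def)
        qed
        thus "c = 0" using ae e0 by simp
      qed
    qed
  qed
  also have "real \<dots> = (\<Sum>x\<in>V. if x \<in> U then 0 else (\<Prod>j<m. real q ^ n - real q ^ (Suc u + j)))"
    unfolding of_nat_sum
  proof (intro sum.cong refl)
    fix x assume x: "x \<in> V"
    show "real (card {g \<in> lin_maps D V. Q x g}) = (if x \<in> U then 0 else (\<Prod>j<m. real q ^ n - real q ^ (Suc u + j)))"
    proof (cases "x \<in> U")
      case True thus ?thesis by (simp add: Q_def)
    next
      case False
      hence "has_dim (Ux x) (Suc u)" using sums_line_has_dim[OF Suc.prems(2)] by (simp add: Ux_def)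
      moreover have "Ux x \<subseteq> V" using x sV Suc.prems(3) by (auto simp: Ux_def intro!: subspace_add subspace_scale)
      ultimately show ?thesis using Suc.IH[OF D] False by (simp add: Q_def)
    qed
  qed
  also have "\<dots> = (real q ^ n - real q ^ u) * (\<Prod>j<m. real q ^ n - real q ^ (Suc u + j))"
    using sum_split_subspace[OF V Suc.prems(2,3), of 0] by simp
  also have "\<dots> = (\<Prod>j<Suc m. real q ^ n - real q ^ (u + j))"
    by (subst prod.lessThan_Suc_shift) simp
  finally show ?case .
qed

lemma card_injective:
  assumes "has_dim V n" "has_dim C m"
  shows "real (card {f \<in> lin_maps C V. \<forall>c\<in>C. f c = 0 \<longrightarrow> c = 0}) = frames n m"
  using card_injective_mod[OF assms, of "{0}" 0] has_dim_subspace[OF assms(1)] subspace_0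
  by (simp add: has_dim_0 frames_def)

section \<open>Gaussian binomial coefficients: subspaces counted through injections\<close>

lemma lin_inj_iff:
  assumes "f \<in> lin_maps V U" "subspace V"
  shows "inj_on f V \<longleftrightarrow> (\<forall>v\<in>V. f v = 0 \<longrightarrow> v = 0)"
proof
  assume "inj_on f V"
  thus "\<forall>v\<in>V. f v = 0 \<longrightarrow> v = 0"
    using lin_zero[OF assms] subspace_0[OF assms(2)] by (metis inj_onD)
next
  assume k: "\<forall>v\<in>V. f v = 0 \<longrightarrow> v = 0"
  show "inj_on f V"
  proof (rule inj_onI)
    fix x y assume "x \<in> V" "y \<in> V" "f x = f y"
    hence "f (x - y) = 0" "x - y \<in> V" using lin_diff[OF assms] subspace_diff[OF assms(2)] by auto
    thus "x = y" using k by auto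
  qed
qed

lemma subspace_of_has_dim_exists:
  assumes "has_dim V n" "r \<le> n"
  obtains W where "has_dim W r" "W \<subseteq> V"
proof -
  have "\<exists>W. has_dim W r \<and> W \<subseteq> V" using assms
  proof (induction n arbitrary: V)
    case 0 thus ?case by auto
  next
    case (Suc n)
    show ?case
    proof (cases "r = Suc n")
      case False
      obtain v C where d: "direct_sum V (line v) C" "has_dim C n" using has_dim_Suc[OF Suc.prems(1)] .
      then obtain W where "has_dim W r \<and> W \<subseteq> C" using Suc False by (metis le_SucE)
      thus ?thesis using direct_sum_sub(2)[OF d(1)] by blast
    qed (use Suc in auto)
  qed
  thus ?thesis using that by blast
qed

text \<open>Injections of an \<open>r\<close>-dimensional space into \<open>V\<close> are grouped by
  image, and each \<open>W\<close> is the image of \<open>frames r r\<close> of them.\<close>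

lemma card_subspaces:
  assumes V: "has_dim V n" and r: "r \<le> n"
  shows "real (card {W. has_dim W r \<and> W \<subseteq> V}) * frames r r = frames n r"
proof -
  \<comment> \<open>A model of dimension \<open>r\<close>, taken within \<open>V\<close> so that the
    ambient type certainly contains it.\<close>
  obtain C where C: "has_dim C r" using subspace_of_has_dim_exists[OF assms] .
  define S where "S = {f \<in> lin_maps C V. \<forall>c\<in>C. f c = 0 \<longrightarrow> c = 0}"
  define T where "T = {W. has_dim W r \<and> W \<subseteq> V}"
  note sC = has_dim_subspace[OF C]
  have fS: "finite S" unfolding S_def using lin_finite[OF has_dim_finite[OF C] has_dim_finite[OF V]] by simp
  have fT: "finite T" unfolding T_def using has_dim_finite[OF V] by (auto intro: finite_subset[of _ "Pow V"])
  have im: "(\<lambda>f. f ` C) ` S \<subseteq> T"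
  proof (rule image_subsetI)
    fix f assume "f \<in> S"
    hence f: "f \<in> lin_maps C V" "inj_on f C" using lin_inj_iff[OF _ sC] by (auto simp: S_def)
    have "subspace (f ` C)" using lin_image_subspace[OF f(1) sC] .
    moreover have "card (f ` C) = q ^ r" using f(2) has_dim_card[OF C] by (simp add: card_image)
    ultimately show "f ` C \<in> T" using lin_in[OF f(1)] by (auto simp: T_def has_dim_def)
  qed
  have "card S = (\<Sum>W\<in>T. card {f \<in> S. f ` C = W})"
    using sum.group[OF fS fT im, of "\<lambda>_. 1 :: nat"] by simp
  also have "real \<dots> = (\<Sum>W\<in>T. frames r r)"
    unfolding of_nat_sum
  proof (intro sum.cong refl)
    fix W assume W: "W \<in> T"
    have "{f \<in> S. f ` C = W} = {f \<in> lin_maps C W. \<forall>c\<in>C. f c = 0 \<longrightarrow> c = 0}"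
    proof (intro equalityI subsetI)
      fix f assume "f \<in> {f \<in> S. f ` C = W}"
      thus "f \<in> {f \<in> lin_maps C W. \<forall>c\<in>C. f c = 0 \<longrightarrow> c = 0}" by (auto simp: S_def intro: lin_codomain)
    next
      fix f assume f: "f \<in> {f \<in> lin_maps C W. \<forall>c\<in>C. f c = 0 \<longrightarrow> c = 0}"
      hence "f \<in> S" using W lin_mono by (auto simp: S_def T_def)
      moreover have "f ` C \<subseteq> W" using f by (auto simp: lin_in)
      moreover have "f ` C \<in> T" using im \<open>f \<in> S\<close> by blast
      ultimately show "f \<in> {f \<in> S. f ` C = W}" using W has_dim_eq[of W r "f ` C"] by (auto simp: T_def)
    qed
    thus "real (card {f \<in> S. f ` C = W}) = frames r r"
      using card_injective[OF _ C] W by (simp add: T_def)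
  qed
  finally show ?thesis using card_injective[OF V C] by (simp add: S_def T_def)
qed

section \<open>Nilpotent maps\<close>

definition nilpotent_on :: "'v set \<Rightarrow> ('v \<Rightarrow> 'v) \<Rightarrow> bool" where
  "nilpotent_on V f \<longleftrightarrow> (\<exists>k. \<forall>v\<in>V. (f ^^ k) v = 0)"

lemma funpow_in: "f \<in> lin_maps V V \<Longrightarrow> v \<in> V \<Longrightarrow> (f ^^ k) v \<in> V"
  by (induction k) (auto simp: lin_in)

text \<open>A restricted map is undefined off its domain, so its powers can be compared with those
  of the original only along orbits that stay in an invariant set.\<close>

lemma funpow_cong:
  assumes "\<And>x. x \<in> Z \<Longrightarrow> f x \<in> Z" "\<And>x. x \<in> Z \<Longrightarrow> g x = f x" "x \<in> Z"
  shows "(g ^^ k) x = (f ^^ k) x \<and> (f ^^ k) x \<in> Z"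
  using assms(3) by (induction k) (auto simp: assms)

lemma funpow_zero: "f \<in> lin_maps V V \<Longrightarrow> subspace V \<Longrightarrow> (f ^^ k) 0 = 0"
  by (induction k) (auto simp: lin_zero)

lemma funpow_add_zero:
  assumes "f \<in> lin_maps V V" "subspace V" "(f ^^ k) v = 0"
  shows "(f ^^ (j + k)) v = 0"
  using assms by (simp add: funpow_add funpow_zero)

lemma nil_restrict:
  assumes "nilpotent_on V f" "Z \<subseteq> V" "\<And>x. x \<in> Z \<Longrightarrow> f x \<in> Z" "\<And>x. x \<in> Z \<Longrightarrow> g x = f x"
  shows "nilpotent_on Z g"
proof -
  obtain k where "\<forall>v\<in>V. (f ^^ k) v = 0" using assms(1) by (auto simp: nilpotent_on_def)
  hence "\<forall>v\<in>Z. (g ^^ k) v = 0" using funpow_cong[of Z f g, OF assms(3,4)] assms(2) by (metis subsetD)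
  thus ?thesis by (auto simp: nilpotent_on_def)
qed

text \<open>If \<open>f\<close> maps \<open>V\<close> onto itself, so do all its powers, and one of
  them is 0.\<close>

lemma nil_image_proper:
  assumes "nilpotent_on V f" "f ` V = V" "subspace V"
  shows "V = {0}"
proof -
  obtain k where k: "\<forall>v\<in>V. (f ^^ k) v = 0" using assms(1) by (auto simp: nilpotent_on_def)
  have "(f ^^ j) ` V = V" for j
  proof (induction j)
    case (Suc j)
    have "(f ^^ Suc j) ` V = f ` (f ^^ j) ` V" by (simp add: image_comp)
    thus ?case using Suc assms(2) by simp
  qed simp
  from this[of k] have "V \<subseteq> {0}" using k by (metis image_subsetI singletonI)
  thus ?thesis using subspace_0[OF assms(3)] by auto
qed

text \<open>Unless \<open>Z\<close> is {0}, its image is an invariant subspace of smaller dimension.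
  By induction that many steps annihilate the image, and one more step suffices for
  \<open>Z\<close>.\<close>

lemma nil_dim:
  assumes "has_dim Z d" "f \<in> lin_maps Z Z" "nilpotent_on Z f" "z \<in> Z"
  shows "(f ^^ d) z = 0"
  using assms
proof (induction d arbitrary: Z f z rule: less_induct)
  case (less d)
  note sZ = has_dim_subspace[OF less.prems(1)]
  show ?case
  proof (cases "d = 0")
    case True thus ?thesis using less.prems by (simp add: has_dim_0)
  next
    case False
    let ?I = "f ` Z"
    have I: "subspace ?I" "?I \<subseteq> Z" using lin_image_subspace[OF less.prems(2) sZ] less.prems(2) lin_in by auto
    obtain e where e: "has_dim ?I e"
      using has_dim_exists[OF I(1)] has_dim_finite[OF less.prems(1)] by blast
    have "?I \<noteq> Z" using nil_image_proper[OF less.prems(3) _ sZ] less.prems(1) False has_dim_0 has_dim_unique by metis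
    hence "e < d" using has_dim_mono[OF less.prems(1) e I(2)] has_dim_eq[OF less.prems(1) _ I(2)] e le_neq_implies_less by blast
    have g: "restrict f ?I \<in> lin_maps ?I ?I"
      by (rule lin_codomain[OF lin_restrict[OF less.prems(2) I(2,1)]]) (use I in auto)
    have cl: "\<And>x. x \<in> ?I \<Longrightarrow> f x \<in> ?I" using I by auto
    have "nilpotent_on ?I (restrict f ?I)" by (rule nil_restrict[OF less.prems(3) I(2) cl]) auto
    hence "(restrict f ?I ^^ e) (f z) = 0" using less.IH[OF \<open>e < d\<close> e g] less.prems(4) by blast
    hence "(f ^^ e) (f z) = 0" using funpow_cong[of ?I f "restrict f ?I" "f z" e, OF cl] less.prems(4) by simp
    hence "(f ^^ Suc e) z = 0" by (simp add: funpow_swap1)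
    hence "(f ^^ (d - Suc e + Suc e)) z = 0" by (rule funpow_add_zero[OF less.prems(2) sZ])
    thus ?thesis using \<open>e < d\<close> by simp
  qed
qed

section \<open>Nilpotent extensions from an invariant subspace\<close>

lemma direct_sum_projection:
  assumes "direct_sum V W C"
  obtains p where "p \<in> lin_maps V C" "\<And>x. x \<in> W \<Longrightarrow> p x = 0" "\<And>x. x \<in> C \<Longrightarrow> p x = x"
    "p ` V = C" "{x\<in>V. p x = 0} = W"
proof -
  note s = direct_sum_sub[OF assms]
  have "(\<lambda>x\<in>W. 0) \<in> lin_maps W C" "(\<lambda>x\<in>C. x) \<in> lin_maps C C"
    using s by (auto intro!: linI simp: subspace_0 subspace_add subspace_scale)
  from lin_glue[OF assms this s(4)] obtain p where
    p: "p \<in> lin_maps V C" "\<And>x. x \<in> W \<Longrightarrow> p x = 0" "\<And>x. x \<in> C \<Longrightarrow> p x = x" by (metis restrict_apply')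
  have "p ` V = C"
  proof (intro equalityI subsetI)
    fix x assume "x \<in> C" thus "x \<in> p ` V" using p(3) s(2) by (metis image_eqI subsetD)
  qed (use lin_in[OF p(1)] in auto)
  moreover have "{x\<in>V. p x = 0} = W"
  proof (intro equalityI subsetI)
    fix x assume x: "x \<in> {x\<in>V. p x = 0}"
    then obtain w c where wc: "w \<in> W" "c \<in> C" "x = w + c" using direct_sumE[OF assms] by blast
    hence "p x = p w + p c" using s lin_add[OF p(1)] by blast
    hence "c = 0" using x wc p by simp
    thus "x \<in> W" using wc by simp
  qed (use p s in auto)
  ultimately show ?thesis using that p by blast
qed

lemma card_by_value:
  assumes "finite S" "finite V" "\<And>A. A \<in> S \<Longrightarrow> g A \<in> V"
  shows "card S = (\<Sum>w\<in>V. card {A \<in> S. g A = w})"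
proof -
  have "g ` S \<subseteq> V" using assms(3) by blast
  from sum.group[OF assms(1,2) this, of "\<lambda>_. 1 :: nat"] show ?thesis by simp
qed

text \<open>Along \<open>K0\<close> and \<open>C\<close> the map \<open>B\<close> is block
  triangular with diagonal blocks \<open>b\<close> and a map on \<open>C\<close>. As
  \<open>b\<close> is nilpotent, \<open>B\<close> is nilpotent iff the second block is; the
  off-diagonal block is arbitrary and gives \<open>q ^ (k0 * k)\<close>.\<close>

lemma card_nil_extensions:
  assumes d: "direct_sum K K0 C" and K0: "has_dim K0 k0" and C: "has_dim C k"
    and b: "b \<in> lin_maps K0 K0" "nilpotent_on K0 b"
  shows "card {B \<in> lin_maps K K. (\<forall>x\<in>K0. B x = b x) \<and> nilpotent_on K B} =
    card {\<beta> \<in> lin_maps C C. nilpotent_on C \<beta>} * q ^ (k0 * k)"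
proof -
  note s = direct_sum_sub[OF d]
  have K: "has_dim K (k0 + k)" using direct_sum_has_dim[OF d K0 C] .
  note sK = has_dim_subspace[OF K]
  obtain p where p: "p \<in> lin_maps K C" "\<And>x. x \<in> K0 \<Longrightarrow> p x = 0" "\<And>x. x \<in> C \<Longrightarrow> p x = x"
    "p ` K = C" "{x\<in>K. p x = 0} = K0" using direct_sum_projection[OF d] by blast
  \<comment> \<open>Since \<open>p\<close> has kernel \<open>K0\<close>, this is the second diagonal
    block: the induced map on the quotient of \<open>K\<close> by \<open>K0\<close>, transported to
    \<open>C\<close>.\<close>
  define \<phi> where "\<phi> f = (\<lambda>x\<in>C. p (f x))" for f :: "'v \<Rightarrow> 'v"
  have \<phi>_lin: "\<phi> f \<in> lin_maps C C" if f: "f \<in> lin_maps C K" for f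
    using s f p(1) by (intro linI) (auto simp: \<phi>_def lin_in lin_add lin_scale subspace_add subspace_scale)
  have nil_iff: "nilpotent_on K B \<longleftrightarrow> nilpotent_on C (\<phi> (restrict B C))"
    if B: "B \<in> lin_maps K K" "\<And>x. x \<in> K0 \<Longrightarrow> B x = b x" for B
  proof -
    let ?g = "\<phi> (restrict B C)"
    have g: "?g \<in> lin_maps C C" using \<phi>_lin lin_restrict[OF B(1) s(2,4)] by blast
    have step: "p (B y) = ?g (p y)" if y: "y \<in> K" for y
    proof -
      obtain w c where wc: "w \<in> K0" "c \<in> C" "y = w + c" using direct_sumE[OF d y] .
      have "B y = B w + B c" using wc s lin_add[OF B(1)] by blast
      hence "p (B y) = p (B w) + p (B c)" using wc s lin_add[OF p(1)] lin_in[OF B(1)] by (metis subsetD)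
      moreover have "p (B w) = 0" using B(2) wc b lin_in p(2) by metis
      moreover have "p y = c" using wc s lin_add[OF p(1)] p(2,3) by (metis add_0 subsetD)
      ultimately show ?thesis using wc by (simp add: \<phi>_def)
    qed
    have it: "p ((B ^^ j) y) = (?g ^^ j) (p y)" if y: "y \<in> K" for y j
      by (induction j) (simp_all add: step funpow_in[OF B(1) y] del: restrict_apply)
    show ?thesis
    proof
      assume "nilpotent_on K B"
      then obtain j where j: "\<And>x. x \<in> K \<Longrightarrow> (B ^^ j) x = 0" by (auto simp: nilpotent_on_def)
      have "(?g ^^ j) c = 0" if "c \<in> C" for c
        using it[of c j] j[of c] p(3)[OF that] lin_zero[OF p(1) sK] s that by auto
      thus "nilpotent_on C ?g" by (auto simp: nilpotent_on_def)
    next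
      assume "nilpotent_on C ?g"
      then obtain j where j: "\<And>x. x \<in> C \<Longrightarrow> (?g ^^ j) x = 0" by (auto simp: nilpotent_on_def)
      obtain i where i: "\<And>x. x \<in> K0 \<Longrightarrow> (b ^^ i) x = 0" using b by (auto simp: nilpotent_on_def)
      \<comment> \<open>The first \<open>j\<close> applications bring \<open>x\<close> into
        \<open>K0\<close>, where the next \<open>i\<close> are those of \<open>b\<close>.\<close>
      have "(B ^^ (i + j)) x = 0" if x: "x \<in> K" for x
      proof -
        have "p ((B ^^ j) x) = 0" using it[OF x] j lin_in[OF p(1) x] by simp
        hence w: "(B ^^ j) x \<in> K0" using p(5) funpow_in[OF B(1) x] by blast
        have "(B ^^ i) ((B ^^ j) x) = (b ^^ i) ((B ^^ j) x)"
          using funpow_cong[of K0 b B "(B ^^ j) x" i] B(2) w lin_in[OF b(1)] by blast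
        thus ?thesis using i[OF w] by (simp add: funpow_add)
      qed
      thus "nilpotent_on K B" by (auto simp: nilpotent_on_def)
    qed
  qed
  define Q where "Q g f \<longleftrightarrow> g = b \<and> nilpotent_on C (\<phi> f)" for g f
  have "card {B \<in> lin_maps K K. (\<forall>x\<in>K0. B x = b x) \<and> nilpotent_on K B} = card {p \<in> lin_maps K0 K \<times> lin_maps C K. Q (fst p) (snd p)}"
  proof (rule card_lin_split[OF d sK])
    fix B assume B: "B \<in> lin_maps K K"
    have "(\<forall>x\<in>K0. B x = b x) \<longleftrightarrow> restrict B K0 = b"
    proof
      assume "\<forall>x\<in>K0. B x = b x"
      thus "restrict B K0 = b" by (intro lin_eqI[OF lin_restrict[OF B s(1,3)] b(1)]) auto
    qed auto
    thus "(\<forall>x\<in>K0. B x = b x) \<and> nilpotent_on K B \<longleftrightarrow> Q (restrict B K0) (restrict B C)"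
      using nil_iff[OF B] unfolding Q_def by blast
  qed
  also have "{p \<in> lin_maps K0 K \<times> lin_maps C K. Q (fst p) (snd p)} = {b} \<times> {f \<in> lin_maps C K. nilpotent_on C (\<phi> f)}"
    using lin_mono[OF b(1) s(1)] by (auto simp: Q_def)
  also have "card \<dots> = card {f \<in> lin_maps C K. nilpotent_on C (\<phi> f)}" by (simp add: card_cartesian_product)
  also have "\<dots> = (\<Sum>\<beta>\<in>{\<beta> \<in> lin_maps C C. nilpotent_on C \<beta>}. card {f \<in> {f \<in> lin_maps C K. nilpotent_on C (\<phi> f)}. \<phi> f = \<beta>})"
    by (rule card_by_value) (use lin_finite has_dim_finite[OF C] has_dim_finite[OF K] \<phi>_lin in auto)
  also have "\<dots> = (\<Sum>\<beta>\<in>{\<beta> \<in> lin_maps C C. nilpotent_on C \<beta>}. q ^ (k0 * k))"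
  proof (intro sum.cong refl)
    fix \<beta> assume \<beta>: "\<beta> \<in> {\<beta> \<in> lin_maps C C. nilpotent_on C \<beta>}"
    have "\<phi> f = \<beta> \<longleftrightarrow> (\<forall>c\<in>C. p (f c) = \<beta> c)" if f: "f \<in> lin_maps C K" for f
    proof
      assume "\<forall>c\<in>C. p (f c) = \<beta> c"
      thus "\<phi> f = \<beta>" using \<beta> by (intro lin_eqI[OF \<phi>_lin[OF f], of \<beta> C]) (auto simp: \<phi>_def)
    qed (auto simp: \<phi>_def)
    hence "{f \<in> {f \<in> lin_maps C K. nilpotent_on C (\<phi> f)}. \<phi> f = \<beta>} = {f \<in> lin_maps C K. \<forall>c\<in>C. p (f c) = \<beta> c}"
      using \<beta> by auto
    also have "card \<dots> = card {x\<in>K. p x = 0} ^ k"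
      by (rule card_lifts[OF p(1,4) sK has_dim_finite[OF K] C]) (use \<beta> in auto)
    finally show "card {f \<in> {f \<in> lin_maps C K. nilpotent_on C (\<phi> f)}. \<phi> f = \<beta>} = q ^ (k0 * k)"
      using p(5) has_dim_card[OF K0] by (simp add: power_mult)
  qed
  finally show ?thesis by simp
qed

section \<open>Flags spanned by independent vectors, and the number of nilpotent maps\<close>

definition flag :: "(nat \<Rightarrow> 'v) \<Rightarrow> nat \<Rightarrow> 'v set" where
  "flag v i = span (v ` {..<i})"

lemma flag_mem: "k < i \<Longrightarrow> v k \<in> flag v i"
  by (auto simp: flag_def intro: span_base)

lemma flag_subspace: "subspace (flag v i)"
  by (simp add: flag_def)

lemma flag_least: "subspace T \<Longrightarrow> (\<And>k. k < i \<Longrightarrow> v k \<in> T) \<Longrightarrow> flag v i \<subseteq> T"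
  unfolding flag_def by (intro span_minimal) auto

lemma flag_cong: "(\<And>k. k < i \<Longrightarrow> v k = w k) \<Longrightarrow> flag v i = flag w i"
  unfolding flag_def by (intro arg_cong[of _ _ span] image_cong) auto

lemma flag_direct_sum:
  assumes "v i \<notin> flag v i"
  shows "direct_sum (flag v (Suc i)) (flag v i) (line (v i))"
proof -
  let ?D = "{u + c |u c. u \<in> flag v i \<and> c \<in> line (v i)}"
  have d: "direct_sum ?D (flag v i) (line (v i))" by (rule direct_sum_line[OF flag_subspace assms])
  note s = direct_sum_sub[OF d]
  have "?D = flag v (Suc i)"
  proof (rule antisym)
    show "flag v (Suc i) \<subseteq> ?D"
    proof (rule flag_least[OF direct_sum_subspace[OF d]])
      fix k assume "k < Suc i"
      hence "v k \<in> flag v i \<or> v k \<in> line (v i)" using flag_mem[of k i v] by (metis less_SucE line_self)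
      thus "v k \<in> ?D" using s by blast
    qed
    have "flag v i \<subseteq> flag v (Suc i)" by (rule flag_least[OF flag_subspace]) (simp add: flag_mem)
    moreover have "line (v i) \<subseteq> flag v (Suc i)"
      using subspace_scale[OF flag_subspace flag_mem[of i "Suc i" v]] by blast
    ultimately show "?D \<subseteq> flag v (Suc i)" using subspace_add[OF flag_subspace] by blast
  qed
  thus ?thesis using d by simp
qed

text \<open>The hypothesis is linear independence in the form in which a chain grows: each vector
  avoids the span of the earlier ones.\<close>

lemma flag_has_dim:
  assumes "\<And>k. k < i \<Longrightarrow> v k \<notin> flag v k"
  shows "has_dim (flag v i) i"
  using assms
proof (induction i)
  case 0 thus ?case by (simp add: has_dim_0 flag_def)
next
  case (Suc i)
  have i: "v i \<notin> flag v i" using Suc.prems by simp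
  hence "v i \<noteq> 0" using subspace_0[OF flag_subspace] by metis
  from direct_sum_has_dim[OF flag_direct_sum[where v=v and i=i, OF i] _ has_dim_line[OF this]] Suc show ?case by simp
qed

lemma lin_on_flag:
  assumes "\<And>k. k < i \<Longrightarrow> v k \<notin> flag v k" "\<And>k. k < i \<Longrightarrow> t k \<in> U" "subspace U"
  obtains b where "b \<in> lin_maps (flag v i) U" "\<And>k. k < i \<Longrightarrow> b (v k) = t k"
proof -
  have "\<exists>b\<in>lin_maps (flag v i) U. \<forall>k<i. b (v k) = t k" using assms
  proof (induction i)
    case 0
    have "(\<lambda>x\<in>{0}. 0) \<in> lin_maps {0} U" using lin_from_zero 0 subspace_0 by blast
    thus ?case by (auto simp: flag_def)
  next
    case (Suc i)
    then obtain b where b: "b \<in> lin_maps (flag v i) U" "\<forall>k<i. b (v k) = t k" by (metis less_SucI)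
    have i: "v i \<notin> flag v i" using Suc.prems by simp
    hence "v i \<noteq> 0" using subspace_0[OF flag_subspace] by metis
    have "t i \<in> (\<lambda>f. f (v i)) ` lin_maps (line (v i)) U"
      using lin_line[OF \<open>v i \<noteq> 0\<close> Suc.prems(3)] Suc.prems(2)[of i] by (simp add: bij_betw_def)
    then obtain g where g: "g \<in> lin_maps (line (v i)) U" "g (v i) = t i" by auto
    obtain f where f: "f \<in> lin_maps (flag v (Suc i)) U" "\<And>x. x \<in> flag v i \<Longrightarrow> f x = b x"
        "\<And>x. x \<in> line (v i) \<Longrightarrow> f x = g x"
      using lin_glue[OF flag_direct_sum[where v=v and i=i, OF i] b(1) g(1) Suc.prems(3)] by blast
    have "f (v k) = t k" if "k < Suc i" for k
      using that f(2)[of "v k"] f(3)[of "v i"] b g flag_mem[of k i v] by (metis less_SucE line_self)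
    thus ?case using f by blast
  qed
  thus ?thesis using that by blast
qed

text \<open>Together with \<open>flag_least\<close> this reduces equality of two linear maps on a
  flag to the spanning vectors; \<open>lin_preimage_subspace\<close> does the same for
  invariance.\<close>

lemma lin_equalizer_subspace:
  assumes "f \<in> lin_maps V U" "g \<in> lin_maps W U'" "subspace V" "subspace W" "Z \<subseteq> V" "Z \<subseteq> W" "subspace Z"
  shows "subspace {x\<in>Z. f x = g x}"
proof (rule subspaceI)
  show "0 \<in> {x\<in>Z. f x = g x}" using assms by (simp add: lin_zero subspace_0)
qed (use assms in \<open>auto simp: subset_iff subspace_add subspace_scale lin_add[OF assms(1)] lin_add[OF assms(2)]
    lin_scale[OF assms(1)] lin_scale[OF assms(2)]\<close>)

lemma lin_preimage_subspace:
  assumes "f \<in> lin_maps V U" "subspace V" "subspace T" "Z \<subseteq> V" "subspace Z"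
  shows "subspace {x\<in>Z. f x \<in> T}"
proof (rule subspaceI)
  show "0 \<in> {x\<in>Z. f x \<in> T}" using assms by (simp add: lin_zero subspace_0)
qed (use assms in \<open>auto simp: subset_iff subspace_add subspace_scale lin_add[OF assms(1)] lin_scale[OF assms(1)]\<close>)

lemma nil_shift_on_flag:
  assumes b: "b \<in> lin_maps (flag v (Suc j)) (flag v (Suc j))"
    and sh: "\<And>k. k < j \<Longrightarrow> b (v k) = v (Suc k)" "b (v j) = 0"
  shows "nilpotent_on (flag v (Suc j)) b"
proof -
  let ?Z = "flag v (Suc j)"
  \<comment> \<open>The tails of the chain: \<open>b\<close> moves each into the next, and
    \<open>T (Suc j)\<close> is the span of the empty set.\<close>
  define T where "T k = span (v ` {k..j})" for k
  have TZ: "T k \<subseteq> ?Z" for k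
    unfolding T_def by (rule span_minimal[OF _ flag_subspace]) (auto intro: flag_mem)
  have step: "b x \<in> T (Suc k)" if "x \<in> T k" for x k
  proof -
    have "T k \<subseteq> {x\<in>?Z. b x \<in> T (Suc k)}"
      unfolding T_def
    proof (rule span_minimal[OF _ lin_preimage_subspace[OF b flag_subspace subspace_span _ flag_subspace]])
      show "v ` {k..j} \<subseteq> {x\<in>?Z. b x \<in> span (v ` {Suc k..j})}"
      proof (rule image_subsetI)
        fix i assume i: "i \<in> {k..j}"
        have "b (v i) \<in> span (v ` {Suc k..j})"
        proof (cases "i < j")
          case True thus ?thesis using i sh(1)[OF True] by (auto intro: span_base)
        next
          case False
          hence "i = j" using i by auto
          thus ?thesis using sh(2) span_zero by simp
        qed
        thus "v i \<in> {x\<in>?Z. b x \<in> span (v ` {Suc k..j})}" using i by (auto intro: flag_mem)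
      qed
    qed auto
    thus ?thesis using that by blast
  qed
  have it: "(b ^^ k) x \<in> T k" if "x \<in> ?Z" for x k
  proof (induction k)
    case 0
    have "{..<Suc j} = {0..j}" by auto
    thus ?case using that by (simp add: T_def flag_def)
  qed (simp add: step)
  have "T (Suc j) = {0}" by (simp add: T_def)
  hence "\<forall>x\<in>?Z. (b ^^ Suc j) x = 0" using it by blast
  thus ?thesis unfolding nilpotent_on_def by blast
qed

text \<open>Fine-Herstein count: reveal a nilpotent \<open>A\<close> along a chain \<open>v 0, A (v 0), A (A (v 0)), ...\<close>.
  As soon as the next vector falls into the span of the previous ones it is \<open>0\<close>, since \<open>A\<close> is nilpotent
  on that span; what remains is a nilpotent map on a complement.\<close>

lemma card_nil_chain_step:
  assumes V: "has_dim V n"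
    and IH: "\<And>k C. k < n \<Longrightarrow> has_dim C k \<Longrightarrow> card {\<beta> \<in> lin_maps C C. nilpotent_on C \<beta>} = q ^ (k * (k - 1))"
    and j: "n = Suc j + d"
    and v: "\<And>i. i \<le> j \<Longrightarrow> v i \<in> V" "\<And>i. i \<le> j \<Longrightarrow> v i \<notin> flag v i"
    and next_count: "\<And>w. w \<in> V \<Longrightarrow> w \<notin> flag v (Suc j) \<Longrightarrow>
      card {A \<in> lin_maps V V. nilpotent_on V A \<and> (\<forall>i<j. A (v i) = v (Suc i)) \<and> A (v j) = w} = N"
  shows "real (card {A \<in> lin_maps V V. nilpotent_on V A \<and> (\<forall>i<j. A (v i) = v (Suc i))}) =
    real q ^ (d * (n - 1)) + (real q ^ n - real q ^ Suc j) * N"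
proof -
  let ?Z = "flag v (Suc j)"
  define S where "S = {A \<in> lin_maps V V. nilpotent_on V A \<and> (\<forall>i<j. A (v i) = v (Suc i))}"
  have Z: "has_dim ?Z (Suc j)" by (rule flag_has_dim) (use v(2) in auto)
  note sV = has_dim_subspace[OF V] and sZ = has_dim_subspace[OF Z]
  have ZV: "?Z \<subseteq> V" by (rule flag_least[OF sV]) (use v(1) in auto)
  have vZ: "v i \<in> ?Z" if "i \<le> j" for i using that by (auto intro: flag_mem)
  \<comment> \<open>The values on the chain when its last vector is sent to 0.\<close>
  define t where "t k = (if k < j then v (Suc k) else 0)" for k
  obtain b where b: "b \<in> lin_maps ?Z ?Z" "\<And>k. k < Suc j \<Longrightarrow> b (v k) = t k"
  proof (rule lin_on_flag[of "Suc j" v t ?Z])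
    fix k assume "k < Suc j" thus "v k \<notin> flag v k" using v(2) by simp
    show "t k \<in> ?Z" using vZ subspace_0[OF sZ] by (simp add: t_def)
  qed (use sZ in auto)
  have bnil: "nilpotent_on ?Z b" by (rule nil_shift_on_flag[OF b(1)]) (use b(2) in \<open>auto simp: t_def\<close>)
  \<comment> \<open>The maps that close the chain are the nilpotent extensions of the shift
    \<open>b\<close>, so \<open>card_nil_extensions\<close> counts them.\<close>
  have S0: "{A \<in> S. A (v j) = 0} = {B \<in> lin_maps V V. (\<forall>x\<in>?Z. B x = b x) \<and> nilpotent_on V B}"
  proof (intro equalityI subsetI)
    fix A assume A: "A \<in> {A \<in> S. A (v j) = 0}"
    hence Al: "A \<in> lin_maps V V" by (simp add: S_def)
    have "?Z \<subseteq> {x\<in>?Z. A x = b x}"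
    proof (rule flag_least[OF lin_equalizer_subspace[OF Al b(1) sV sZ ZV _ sZ]])
      fix k assume k: "k < Suc j"
      hence "A (v k) = t k" using A by (auto simp: S_def t_def less_Suc_eq)
      thus "v k \<in> {x\<in>?Z. A x = b x}" using b(2)[OF k] vZ k by simp
    qed auto
    thus "A \<in> {B \<in> lin_maps V V. (\<forall>x\<in>?Z. B x = b x) \<and> nilpotent_on V B}" using A by (auto simp: S_def)
  next
    fix B assume B: "B \<in> {B \<in> lin_maps V V. (\<forall>x\<in>?Z. B x = b x) \<and> nilpotent_on V B}"
    hence "B (v k) = t k" if "k < Suc j" for k using b(2)[OF that] vZ that by simp
    thus "B \<in> {A \<in> S. A (v j) = 0}" using B by (simp add: S_def t_def)
  qed
  obtain C where C: "direct_sum V ?Z C" "has_dim C (n - Suc j)" using complement_has_dim[OF V Z ZV] .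
  have Cd: "has_dim C d" using C(2) j by simp
  have c0: "card {A \<in> S. A (v j) = 0} = q ^ (d * (n - 1))"
  proof -
    have "card {A \<in> S. A (v j) = 0} = q ^ (d * (d - 1)) * q ^ (Suc j * d)"
      unfolding S0 card_nil_extensions[OF C(1) Z Cd b(1) bnil] using IH[OF _ Cd] j by simp
    \<comment> \<open>Since n = j+1+d, the exponents add up: d(d-1) + (j+1)d = d(n-1).\<close>
    also have "\<dots> = q ^ (d * (n - 1))"
      unfolding power_add[symmetric] j by (cases d) (simp_all add: algebra_simps)
    finally show ?thesis .
  qed
  have cZ: "w = 0" if A: "A \<in> S" "A (v j) = w" and w: "w \<in> ?Z" for A w
  proof -
    have Al: "A \<in> lin_maps V V" and An: "nilpotent_on V A" and Ash: "\<And>i. i < j \<Longrightarrow> A (v i) = v (Suc i)"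
      using A by (auto simp: S_def)
    have "?Z \<subseteq> {x\<in>?Z. A x \<in> ?Z}"
    proof (rule flag_least[OF lin_preimage_subspace[OF Al sV sZ ZV sZ]])
      fix k assume k: "k < Suc j"
      have "A (v k) \<in> ?Z"
        using k A w Ash vZ[of "Suc k"] by (cases "k < j") (auto simp: less_Suc_eq)
      thus "v k \<in> {x\<in>?Z. A x \<in> ?Z}" using vZ k by simp
    qed
    hence inv: "\<And>x. x \<in> ?Z \<Longrightarrow> A x \<in> ?Z" by blast
    have g: "restrict A ?Z \<in> lin_maps ?Z ?Z"
      by (rule lin_codomain[OF lin_restrict[OF Al ZV sZ]]) (simp add: inv)
    have gn: "nilpotent_on ?Z (restrict A ?Z)" by (rule nil_restrict[OF An ZV inv]) auto
    \<comment> \<open>\<open>?Z\<close> is invariant of dimension \<open>Suc j\<close>, so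
      \<open>Suc j\<close> applications annihilate \<open>v 0\<close>; followed along the chain,
      they lead to \<open>A (v j) = w\<close>.\<close>
    have "(restrict A ?Z ^^ Suc j) (v 0) = 0" by (rule nil_dim[OF Z g gn]) (simp add: vZ)
    hence "(A ^^ Suc j) (v 0) = 0"
      using funpow_cong[of ?Z A "restrict A ?Z" "v 0" "Suc j", OF inv] vZ[of 0] by simp
    moreover have "(A ^^ k) (v 0) = v k" if "k \<le> j" for k
      using that by (induction k) (auto simp: Ash)
    ultimately show ?thesis using A by simp
  qed
  have fS: "finite S" unfolding S_def using lin_finite[OF has_dim_finite[OF V] has_dim_finite[OF V]] by simp
  have "card S = (\<Sum>w\<in>V. card {A \<in> S. A (v j) = w})"
    by (rule card_by_value[OF fS has_dim_finite[OF V]]) (use v(1) in \<open>auto simp: S_def lin_in\<close>)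
  also have "\<dots> = (\<Sum>w\<in>V. (if w = 0 then q ^ (d * (n - 1)) else 0) + (if w \<in> ?Z then 0 else N))"
  proof (intro sum.cong refl)
    fix w assume w: "w \<in> V"
    consider "w = 0" | "w \<noteq> 0" "w \<in> ?Z" | "w \<notin> ?Z" by blast
    thus "card {A \<in> S. A (v j) = w} = (if w = 0 then q ^ (d * (n - 1)) else 0) + (if w \<in> ?Z then 0 else N)"
    proof cases
      case 1 thus ?thesis using c0 subspace_0[OF sZ] by simp
    next
      case 2
      hence "{A \<in> S. A (v j) = w} = {}" using cZ by blast
      hence "card {A \<in> S. A (v j) = w} = 0" by (metis card.empty)
      thus ?thesis using 2 by simp
    next
      case 3
      hence "w \<noteq> 0" using subspace_0[OF sZ] by metis
      moreover have "{A \<in> S. A (v j) = w} =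
        {A \<in> lin_maps V V. nilpotent_on V A \<and> (\<forall>i<j. A (v i) = v (Suc i)) \<and> A (v j) = w}" by (auto simp: S_def)
      ultimately show ?thesis using 3 next_count[OF w 3] by simp
    qed
  qed
  finally have "real (card S) = real q ^ (d * (n - 1)) + (\<Sum>w\<in>V. if w \<in> ?Z then 0 else real N)"
    using has_dim_finite[OF V] subspace_0[OF sV]
    by (simp add: sum.distrib sum.delta if_distrib[of real] cong: if_cong)
  thus ?thesis using sum_split_subspace[OF V Z ZV, of 0 "real N"] by (simp add: S_def)
qed

text \<open>Induction on \<open>d\<close>, the number of dimensions the chain has yet to fill. In
  the step, closing the chain contributes q^((d+1)(n-1)) = q^(j+1) q^(nd), which is what the q^(j+1)
  vectors of the flag would contribute at q^(nd) each. The count is thus the same as if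
  \<open>A (v j)\<close> ranged freely over \<open>V\<close>.\<close>

lemma card_nil_chain:
  assumes V: "has_dim V n"
    and IH: "\<And>k C. k < n \<Longrightarrow> has_dim C k \<Longrightarrow> card {\<beta> \<in> lin_maps C C. nilpotent_on C \<beta>} = q ^ (k * (k - 1))"
    and j: "n = Suc j + d"
    and v: "\<And>i. i \<le> j \<Longrightarrow> v i \<in> V" "\<And>i. i \<le> j \<Longrightarrow> v i \<notin> flag v i"
  shows "card {A \<in> lin_maps V V. nilpotent_on V A \<and> (\<forall>i<j. A (v i) = v (Suc i))} = q ^ (n * d)"
  using j v
proof (induction d arbitrary: j v)
  case base: 0
  show ?case
  proof -
    \<comment> \<open>A chain of full length spans \<open>V\<close>; no \<open>w\<close> lies
      outside, so the premise on the continuations holds vacuously with 0.\<close>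
    have "flag v (Suc j) = V"
      using has_dim_eq[OF V] flag_has_dim[of "Suc j" v] flag_least[of V "Suc j" v] has_dim_subspace[OF V] base.prems
      by (simp add: less_Suc_eq_le)
    hence "real (card {A \<in> lin_maps V V. nilpotent_on V A \<and> (\<forall>i<j. A (v i) = v (Suc i))}) =
        real q ^ (0 * (n - 1)) + (real q ^ n - real q ^ Suc j) * real 0"
      by (intro card_nil_chain_step[OF V IH base.prems]) auto
    thus ?thesis by simp
  qed
next
  case (Suc d)
  have "card {A \<in> lin_maps V V. nilpotent_on V A \<and> (\<forall>i<j. A (v i) = v (Suc i)) \<and> A (v j) = w} = q ^ (n * d)"
    if w: "w \<in> V" "w \<notin> flag v (Suc j)" for w
  proof -
    define u where "u = v(Suc j := w)"
    have fl: "flag u i = flag v i" if "i \<le> Suc j" for i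
      by (rule flag_cong) (use that in \<open>auto simp: u_def\<close>)
    have "{A \<in> lin_maps V V. nilpotent_on V A \<and> (\<forall>i<j. A (v i) = v (Suc i)) \<and> A (v j) = w} =
      {A \<in> lin_maps V V. nilpotent_on V A \<and> (\<forall>i<Suc j. A (u i) = u (Suc i))}"
      by (auto simp: u_def less_Suc_eq)
    also have "card \<dots> = q ^ (n * d)"
    proof (rule Suc.IH)
      fix i assume i: "i \<le> Suc j"
      show "u i \<in> V" using Suc.prems(2) w i by (auto simp: u_def)
      show "u i \<notin> flag u i" using Suc.prems(3) w i fl[OF i] by (auto simp: u_def)
    qed (use Suc.prems in simp)
    finally show ?thesis .
  qed
  hence "real (card {A \<in> lin_maps V V. nilpotent_on V A \<and> (\<forall>i<j. A (v i) = v (Suc i))}) =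
      real q ^ (Suc d * (n - 1)) + (real q ^ n - real q ^ Suc j) * real (q ^ (n * d))"
    by (intro card_nil_chain_step[OF V IH Suc.prems]) auto
  also have "\<dots> = real (q ^ (n * Suc d))"
  proof -
    have "Suc d * (n - 1) = Suc j + n * d" using Suc.prems(1) by (simp add: algebra_simps)
    thus ?thesis by (simp add: algebra_simps power_add)
  qed
  finally show ?case by (simp only: of_nat_eq_iff)
qed

lemma card_nil: "has_dim V n \<Longrightarrow> card {\<beta> \<in> lin_maps V V. nilpotent_on V \<beta>} = q ^ (n * (n - 1))"
proof (induction n arbitrary: V rule: less_induct)
  case (less n)
  show ?case
  proof (cases n)
    case 0
    hence V: "V = {0}" using less.prems by (simp add: has_dim_0)
    have "{\<beta> \<in> lin_maps V V. nilpotent_on V \<beta>} = lin_maps V V" by (auto simp: V nilpotent_on_def intro: exI[of _ 0])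
    thus ?thesis using 0 lin_from_zero[of "{0}"] by (simp add: V)
  next
    case (Suc d)
    hence "V \<noteq> {0}" using less.prems has_dim_0 has_dim_unique by blast
    then obtain x where x: "x \<in> V" "x \<noteq> 0" using less.prems has_dim_subspace subspace_0 by blast
    \<comment> \<open>A chain consisting of one nonzero vector imposes no condition on
      \<open>A\<close>: take \<open>j = 0\<close> and \<open>d = n - 1\<close>.\<close>
    have "card {A \<in> lin_maps V V. nilpotent_on V A \<and> (\<forall>i<0. A ((\<lambda>_. x) i) = (\<lambda>_. x) (Suc i))} = q ^ (n * d)"
      by (rule card_nil_chain[OF less.prems less.IH]) (use Suc x in \<open>auto simp: flag_def\<close>)
    thus ?thesis using Suc by simp
  qed
qed

section \<open>Commuting nilpotent pairs\<close>

text \<open>On a complement of \<open>W\<close> the values must generate \<open>W\<close> modulo the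
  part a(W) that is already reached; this is the count of \<open>card_spanning\<close> with a(W) as
  \<open>U\<close>.\<close>

lemma card_extensions_onto:
  assumes V: "has_dim V n" and W: "has_dim W r" "W \<subseteq> V" and a: "a \<in> lin_maps W W" and s: "has_dim (a ` W) s"
  shows "real (card {A \<in> lin_maps V V. (\<forall>x\<in>W. A x = a x) \<and> A ` V = W}) =
    real q ^ ((n - r) * s) * frames (n - r) (r - s)"
proof -
  obtain C where d: "direct_sum V W C" and C: "has_dim C (n - r)" using complement_has_dim[OF V W] .
  note ss = direct_sum_sub[OF d]
  have aW: "a ` W \<subseteq> W" using lin_in[OF a] by blast
  define Q where "Q g h \<longleftrightarrow> g = a \<and> W \<subseteq> {x + h c |x c. x \<in> a ` W \<and> c \<in> C}" for g h
  have "{A \<in> lin_maps V V. (\<forall>x\<in>W. A x = a x) \<and> A ` V = W} = {A \<in> lin_maps V W. (\<forall>x\<in>W. A x = a x) \<and> W \<subseteq> A ` V}"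
  proof (intro equalityI subsetI)
    fix A assume "A \<in> {A \<in> lin_maps V V. (\<forall>x\<in>W. A x = a x) \<and> A ` V = W}"
    thus "A \<in> {A \<in> lin_maps V W. (\<forall>x\<in>W. A x = a x) \<and> W \<subseteq> A ` V}" by (auto intro: lin_codomain)
  next
    fix A assume A: "A \<in> {A \<in> lin_maps V W. (\<forall>x\<in>W. A x = a x) \<and> W \<subseteq> A ` V}"
    hence "A ` V \<subseteq> W" using lin_in by blast
    thus "A \<in> {A \<in> lin_maps V V. (\<forall>x\<in>W. A x = a x) \<and> A ` V = W}" using A lin_mono[OF _ W(2)] by blast
  qed
  also have "card \<dots> = card {p \<in> lin_maps W W \<times> lin_maps C W. Q (fst p) (snd p)}"
  proof (rule card_lin_split[OF d ss(3)])
    fix A assume A: "A \<in> lin_maps V W"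
    have e: "(\<forall>x\<in>W. A x = a x) \<longleftrightarrow> restrict A W = a"
    proof
      assume "\<forall>x\<in>W. A x = a x"
      thus "restrict A W = a" by (intro lin_eqI[OF lin_restrict[OF A ss(1,3)] a]) auto
    qed auto
    have im: "A ` V = {x + restrict A C c |x c. x \<in> a ` W \<and> c \<in> C}" if Aa: "\<forall>x\<in>W. A x = a x"
    proof (intro equalityI subsetI)
      fix y assume "y \<in> A ` V"
      then obtain w c where wc: "w \<in> W" "c \<in> C" "y = A (w + c)" using direct_sumE[OF d] by blast
      hence "y = a w + restrict A C c" using lin_add[OF A] ss Aa by (simp add: subset_iff)
      thus "y \<in> {x + restrict A C c |x c. x \<in> a ` W \<and> c \<in> C}" using wc by blast
    next
      fix y assume "y \<in> {x + restrict A C c |x c. x \<in> a ` W \<and> c \<in> C}"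
      then obtain w c where wc: "w \<in> W" "c \<in> C" "y = a w + A c" by auto
      hence "y = A (w + c)" using lin_add[OF A] ss Aa by (simp add: subset_iff)
      thus "y \<in> A ` V" using direct_sum_add[OF d wc(1,2)] by blast
    qed
    show "(\<forall>x\<in>W. A x = a x) \<and> W \<subseteq> A ` V \<longleftrightarrow> Q (restrict A W) (restrict A C)"
    proof (cases "\<forall>x\<in>W. A x = a x")
      case True
      thus ?thesis using e unfolding Q_def im[OF True, symmetric] by blast
    qed (use e in \<open>unfold Q_def, blast\<close>)
  qed
  also have "{p \<in> lin_maps W W \<times> lin_maps C W. Q (fst p) (snd p)} =
      {a} \<times> {h \<in> lin_maps C W. W \<subseteq> {x + h c |x c. x \<in> a ` W \<and> c \<in> C}}"
    using a by (auto simp: Q_def)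
  also have "card \<dots> = card {h \<in> lin_maps C W. W \<subseteq> {x + h c |x c. x \<in> a ` W \<and> c \<in> C}}"
    by (simp add: card_cartesian_product)
  finally show ?thesis using card_spanning[OF W(1) C s aW] by simp
qed

text \<open>Let \<open>K = ker A\<close>. An extension \<open>B\<close> commuting with \<open>A\<close> preserves \<open>K\<close>, and it is nilpotent iff its
  restriction to \<open>K\<close> is: the powers of \<open>B\<close> eventually map \<open>V\<close> into \<open>K\<close>, because \<open>A\<close> intertwines them with
  those of \<open>b\<close>. On a complement of \<open>W + K\<close> the values of \<open>B\<close> are determined modulo \<open>K\<close>.\<close>

lemma card_commuting_nil_extensions:
  assumes V: "has_dim V n" and A: "A \<in> lin_maps V V" "A ` V = W" and W: "has_dim W r"
    and s: "has_dim (A ` W) s"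
    and b: "b \<in> lin_maps W W" "nilpotent_on W b" and com: "\<And>x. x \<in> W \<Longrightarrow> A (b x) = b (A x)"
    and k: "n - r = k + (r - s)"
  shows "card {B \<in> lin_maps V V. (\<forall>x\<in>W. B x = b x) \<and> (\<forall>x\<in>V. A (B x) = B (A x)) \<and> nilpotent_on V B} =
    q ^ (k * (k - 1) + (r - s) * k + (n - r) * (r - s))"
proof -
  note sV = has_dim_subspace[OF V] and sW = has_dim_subspace[OF W] and fV = has_dim_finite[OF V]
  have WV: "W \<subseteq> V" using A lin_in by blast
  have rn: "r \<le> n" using has_dim_mono[OF V W WV] .
  have q0: "q > 0" using q_ge_2 by simp
  define K where "K = {x\<in>V. A x = 0}"
  define K0 where "K0 = {x\<in>W. A x = 0}"
  have AW: "A ` W \<subseteq> W" using A WV by blast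
  have sr: "s \<le> r" using has_dim_mono[OF W s AW] .
  have AVW: "A \<in> lin_maps V W" using lin_codomain[OF A(1)] A(2) by blast
  have sK: "subspace K" unfolding K_def by (rule lin_ker_subspace[OF A(1) sV])
  have sK0: "subspace K0" unfolding K0_def
    using lin_ker_subspace[OF lin_restrict[OF A(1) WV sW] sW] by (simp cong: conj_cong)
  have K: "has_dim K (n - r)"
  proof -
    have "q ^ n = q ^ r * card K"
      using rank_nullity[OF A(1) sV fV] has_dim_card[OF V] has_dim_card[OF W] A(2) by (simp add: K_def)
    also have "q ^ n = q ^ r * q ^ (n - r)" using rn by (simp add: power_add[symmetric])
    finally show ?thesis using sK q0 by (simp add: has_dim_def)
  qed
  have K0: "has_dim K0 (r - s)"
  proof -
    have "card W = card (restrict A W ` W) * card {x\<in>W. restrict A W x = 0}"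
      by (rule rank_nullity[OF lin_restrict[OF A(1) WV sW] sW has_dim_finite[OF W]])
    moreover have "restrict A W ` W = A ` W" by auto
    moreover have "{x\<in>W. restrict A W x = 0} = K0" by (auto simp: K0_def)
    ultimately have "q ^ r = q ^ s * card K0" using has_dim_card[OF W] has_dim_card[OF s] by simp
    also have "q ^ r = q ^ s * q ^ (r - s)" using sr by (simp add: power_add[symmetric])
    finally show ?thesis using sK0 q0 by (simp add: has_dim_def)
  qed
  have K0K: "K0 \<subseteq> K" using WV by (auto simp: K_def K0_def)
  \<comment> \<open>By rank-nullity on \<open>V\<close> and on \<open>W\<close>, the hypothesis on
    \<open>k\<close> makes it the codimension of \<open>K0\<close> in \<open>K\<close>.\<close>
  obtain C1 where d1: "direct_sum K K0 C1" and C1': "has_dim C1 (n - r - (r - s))" using complement_has_dim[OF K K0 K0K] .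
  have C1: "has_dim C1 k" using C1' k by simp
  note s1 = direct_sum_sub[OF d1]
  \<comment> \<open>This is \<open>W + K\<close>: as \<open>W\<close> meets \<open>K\<close> in
    \<open>K0\<close>, a complement of \<open>K0\<close> in \<open>K\<close> is also a complement of
    \<open>W\<close> in that sum.\<close>
  define Y where "Y = {w + c |w c. w \<in> W \<and> c \<in> C1}"
  have "W \<inter> C1 \<subseteq> K0 \<inter> C1" using s1(2) by (auto simp: K_def K0_def)
  moreover have "K0 \<inter> C1 = {0}" using d1 by (simp add: direct_sum_def)
  ultimately have "W \<inter> C1 = {0}" using subspace_0[OF sW] subspace_0[OF s1(4)] by blast
  hence dY: "direct_sum Y W C1" using sW s1(4) unfolding direct_sum_def Y_def by blast
  note sY = direct_sum_sub[OF dY] and ssY = direct_sum_subspace[OF dY]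
  have Y: "has_dim Y (r + k)" by (rule direct_sum_has_dim[OF dY W C1])
  have KV: "K \<subseteq> V" by (auto simp: K_def)
  have YV: "Y \<subseteq> V" using WV s1(2) KV sV by (auto simp: Y_def intro!: subspace_add)
  have KY: "K \<subseteq> Y"
  proof
    fix x assume "x \<in> K"
    then obtain w c where "w \<in> K0" "c \<in> C1" "x = w + c" using direct_sumE[OF d1] by blast
    thus "x \<in> Y" by (auto simp: Y_def K0_def)
  qed
  obtain C2 where d2: "direct_sum V Y C2" and C2': "has_dim C2 (n - (r + k))" using complement_has_dim[OF V Y YV] .
  have "n - (r + k) = r - s" using k by simp
  hence C2: "has_dim C2 (r - s)" using C2' by simp
  note s2 = direct_sum_sub[OF d2]
  have bA: "b (A x) \<in> W" if "x \<in> V" for x using that A lin_in[OF b(1)] by blast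
  \<comment> \<open>The data of \<open>B\<close> split into independent halves. \<open>G\<close>
    concerns \<open>W + K\<close>, where \<open>B\<close> is given on \<open>W\<close> and must be
    nilpotent on \<open>K\<close>; \<open>H\<close> concerns \<open>C2\<close>, where commuting with
    \<open>A\<close> fixes the values modulo \<open>K\<close>.\<close>
  define G where "G = {g \<in> lin_maps Y V. (\<forall>x\<in>W. g x = b x) \<and> (\<forall>x\<in>K. g x \<in> K) \<and> nilpotent_on K (restrict g K)}"
  define H where "H = {h \<in> lin_maps C2 V. \<forall>c\<in>C2. A (h c) = (\<lambda>c\<in>C2. b (A c)) c}"
  have "card {B \<in> lin_maps V V. (\<forall>x\<in>W. B x = b x) \<and> (\<forall>x\<in>V. A (B x) = B (A x)) \<and> nilpotent_on V B} =
    card {p \<in> lin_maps Y V \<times> lin_maps C2 V. fst p \<in> G \<and> snd p \<in> H}"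
  proof (rule card_lin_split[OF d2 sV])
    fix B assume B: "B \<in> lin_maps V V"
    show "((\<forall>x\<in>W. B x = b x) \<and> (\<forall>x\<in>V. A (B x) = B (A x)) \<and> nilpotent_on V B) \<longleftrightarrow>
      restrict B Y \<in> G \<and> restrict B C2 \<in> H"
    proof (intro iffI conjI)
      assume L: "(\<forall>x\<in>W. B x = b x) \<and> (\<forall>x\<in>V. A (B x) = B (A x)) \<and> nilpotent_on V B"
      have BK: "B x \<in> K" if "x \<in> K" for x
      proof -
        have "A (B x) = B 0" using L that by (auto simp: K_def)
        thus ?thesis using that lin_zero[OF B sV] lin_in[OF B] by (simp add: K_def)
      qed
      have "nilpotent_on K (restrict (restrict B Y) K)"
        by (rule nil_restrict[OF _ KV, of B]) (use L BK KY in auto)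
      thus "restrict B Y \<in> G"
        using L BK KY sY(1) lin_restrict[OF B YV ssY] by (auto simp: G_def subset_iff)
      show "restrict B C2 \<in> H"
        using L lin_restrict[OF B s2(2,4)] s2(2) A(2) by (auto simp: H_def subset_iff)
    next
      assume R: "restrict B Y \<in> G \<and> restrict B C2 \<in> H"
      have BW: "B x = b x" if "x \<in> W" for x
      proof -
        have "restrict B Y x = b x" using R that by (simp add: G_def)
        thus ?thesis using that sY(1) by auto
      qed
      thus "\<forall>x\<in>W. B x = b x" by blast
      have BK: "B x \<in> K" if "x \<in> K" for x
      proof -
        have "restrict B Y x \<in> K" using R that by (simp add: G_def)
        thus ?thesis using that KY by auto
      qed
      have BC: "A (B c) = b (A c)" if "c \<in> C2" for c
      proof -
        have "A (restrict B C2 c) = restrict (\<lambda>c. b (A c)) C2 c" using R that unfolding H_def by blast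
        thus ?thesis using that by simp
      qed
      \<comment> \<open>Commuting is linear in the vector, so it is checked on three summands: on
        \<open>W\<close> by \<open>com\<close>, on \<open>C1\<close> because both sides are 0, on
        \<open>C2\<close> by the condition in \<open>H\<close>.\<close>
      have c1: "A (B x) = B (A x)" if "x \<in> W" for x
        using that BW com[OF that] AW by (metis imageI subsetD)
      have c2: "A (B x) = B (A x)" if "x \<in> C1" for x
      proof -
        have "x \<in> K" using that s1 by blast
        thus ?thesis using BK[of x] lin_zero[OF B sV] by (simp add: K_def)
      qed
      have c3: "A (B x) = B (A x)" if "x \<in> C2" for x
        using BC[OF that] BW[of "A x"] that s2 A(2) by auto
      have cadd: "A (B (x + y)) = B (A (x + y))"
        if "x \<in> V" "y \<in> V" "A (B x) = B (A x)" "A (B y) = B (A y)" for x y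
        using that lin_add[OF A(1)] lin_add[OF B] lin_in[OF A(1)] lin_in[OF B] by simp
      have cV: "A (B x) = B (A x)" if x: "x \<in> V" for x
      proof -
        obtain y c where yc: "y \<in> Y" "c \<in> C2" "x = y + c" using direct_sumE[OF d2 x] .
        obtain w e where we: "w \<in> W" "e \<in> C1" "y = w + e" using direct_sumE[OF dY yc(1)] .
        have "w \<in> V" "e \<in> V" "y \<in> V" "c \<in> V" using yc we WV s1 KV YV s2 by auto
        hence "A (B y) = B (A y)" using cadd[OF _ _ c1[OF we(1)] c2[OF we(2)]] we(3) by simp
        thus ?thesis using cadd[OF _ _ _ c3[OF yc(2)]] \<open>y \<in> V\<close> \<open>c \<in> V\<close> yc(3) by simp
      qed
      thus "\<forall>x\<in>V. A (B x) = B (A x)" by blast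
      have it: "A ((B ^^ j) x) = (b ^^ j) (A x)" if x: "x \<in> V" for x j
      proof (induction j)
        case (Suc j)
        have "A ((B ^^ Suc j) x) = B (A ((B ^^ j) x))" using cV funpow_in[OF B x] by simp
        also have "\<dots> = b (A ((B ^^ j) x))" using BW funpow_in[OF B x] A(2) by blast
        finally show ?case using Suc by simp
      qed simp
      obtain i where i: "\<And>x. x \<in> W \<Longrightarrow> (b ^^ i) x = 0" using b by (auto simp: nilpotent_on_def)
      have "nilpotent_on K (restrict (restrict B Y) K)" using R by (simp add: G_def)
      hence "nilpotent_on K B" by (rule nil_restrict) (use BK KY in \<open>auto simp: subset_iff\<close>)
      then obtain j where j: "\<And>x. x \<in> K \<Longrightarrow> (B ^^ j) x = 0" by (auto simp: nilpotent_on_def)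
      have "(B ^^ (j + i)) x = 0" if x: "x \<in> V" for x
      proof -
        have "A ((B ^^ i) x) = 0" using it[OF x] i x A(2) by auto
        hence "(B ^^ i) x \<in> K" using funpow_in[OF B x] by (simp add: K_def)
        thus ?thesis using j by (simp add: funpow_add)
      qed
      thus "nilpotent_on V B" by (auto simp: nilpotent_on_def)
    qed
  qed
  also have "{p \<in> lin_maps Y V \<times> lin_maps C2 V. fst p \<in> G \<and> snd p \<in> H} = G \<times> H"
    by (auto simp: G_def H_def)
  also have "card \<dots> = card G * card H" by (simp add: card_cartesian_product)
  also have "card H = q ^ ((n - r) * (r - s))"
  proof -
    have "(\<lambda>c\<in>C2. b (A c)) \<in> lin_maps C2 W"
      using s2 A(2) b(1) WV
      by (intro linI) (auto simp: subset_iff lin_in bA lin_add[OF A(1)] lin_scale[OF A(1)] lin_add[OF b(1)]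
        lin_scale[OF b(1)] subspace_add subspace_scale)
    from card_lifts[OF AVW A(2) sV fV C2 this] show ?thesis
      using has_dim_card[OF K] by (simp add: H_def K_def power_mult)
  qed
  \<comment> \<open>Being prescribed on \<open>W\<close>, an element of \<open>G\<close> is
    determined by its restriction to \<open>K\<close>, which may be any nilpotent extension of
    \<open>b\<close> from \<open>K0\<close>, the intersection of \<open>W\<close> and
    \<open>K\<close>.\<close>
  also have "card G = card {\<beta> \<in> lin_maps K K. (\<forall>x\<in>K0. \<beta> x = b x) \<and> nilpotent_on K \<beta>}"
  proof (rule bij_betw_same_card[of "\<lambda>g. restrict g K"], unfold bij_betw_def, intro conjI)
    show "inj_on (\<lambda>g. restrict g K) G"
    proof (rule inj_onI)
      fix g h assume gh: "g \<in> G" "h \<in> G" "restrict g K = restrict h K"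
      show "g = h"
      proof (rule lin_direct_sum_eqI[OF dY, of g V h V])
        fix x assume "x \<in> C1"
        hence "x \<in> K" using s1 by blast
        thus "g x = h x" using gh(3) by (metis restrict_apply')
      qed (use gh in \<open>auto simp: G_def\<close>)
    qed
    show "(\<lambda>g. restrict g K) ` G = {\<beta> \<in> lin_maps K K. (\<forall>x\<in>K0. \<beta> x = b x) \<and> nilpotent_on K \<beta>}"
    proof (intro equalityI subsetI)
      fix \<beta> assume "\<beta> \<in> (\<lambda>g. restrict g K) ` G"
      then obtain g where g: "g \<in> G" "\<beta> = restrict g K" by blast
      have "\<beta> \<in> lin_maps K K"
        unfolding g(2) by (rule lin_codomain[OF lin_restrict[of g Y V, OF _ KY sK]]) (use g in \<open>auto simp: G_def\<close>)
      thus "\<beta> \<in> {\<beta> \<in> lin_maps K K. (\<forall>x\<in>K0. \<beta> x = b x) \<and> nilpotent_on K \<beta>}"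
        using g K0K by (auto simp: G_def K0_def subset_iff)
    next
      fix \<beta> assume \<beta>: "\<beta> \<in> {\<beta> \<in> lin_maps K K. (\<forall>x\<in>K0. \<beta> x = b x) \<and> nilpotent_on K \<beta>}"
      hence \<beta>l: "\<beta> \<in> lin_maps K K" by simp
      obtain g where g: "g \<in> lin_maps Y V" "\<And>x. x \<in> W \<Longrightarrow> g x = b x" "\<And>x. x \<in> C1 \<Longrightarrow> g x = restrict \<beta> C1 x"
        using lin_glue[OF dY lin_mono[OF b(1) WV] lin_mono[OF lin_restrict[OF \<beta>l s1(2,4)] KV] sV] by blast
      have gK: "restrict g K = \<beta>"
      proof (rule lin_direct_sum_eqI[OF d1 lin_restrict[OF g(1) KY sK] \<beta>l])
        fix x assume "x \<in> K0"
        thus "restrict g K x = \<beta> x" using g(2) \<beta> K0K by (auto simp: K0_def)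
      next
        fix x assume "x \<in> C1"
        thus "restrict g K x = \<beta> x" using g(3) s1 by auto
      qed
      have "g x \<in> K" if "x \<in> K" for x
        using lin_in[OF \<beta>l that] gK that by (metis restrict_apply')
      hence "g \<in> G" using g(1,2) gK \<beta> by (simp add: G_def)
      thus "\<beta> \<in> (\<lambda>g. restrict g K) ` G" using gK by blast
    qed
  qed
  also have "\<dots> = card {\<beta> \<in> lin_maps K K. (\<forall>x\<in>K0. \<beta> x = restrict b K0 x) \<and> nilpotent_on K \<beta>}"
    by (rule arg_cong[of _ _ card]) auto
  also have "\<dots> = q ^ (k * (k - 1)) * q ^ ((r - s) * k)"
  proof -
    have inv: "b x \<in> K0" if "x \<in> K0" for x
    proof -
      have "A (b x) = b 0" using com[of x] that by (simp add: K0_def)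
      thus ?thesis using that lin_zero[OF b(1) sW] lin_in[OF b(1)] by (simp add: K0_def)
    qed
    have K0W: "K0 \<subseteq> W" by (auto simp: K0_def)
    have "restrict b K0 \<in> lin_maps K0 K0"
      by (rule lin_codomain[OF lin_restrict[OF b(1) K0W sK0]]) (simp add: inv)
    moreover have "nilpotent_on K0 (restrict b K0)" by (rule nil_restrict[OF b(2) K0W inv]) auto
    ultimately have "card {\<beta> \<in> lin_maps K K. (\<forall>x\<in>K0. \<beta> x = restrict b K0 x) \<and> nilpotent_on K \<beta>} =
        card {\<beta> \<in> lin_maps C1 C1. nilpotent_on C1 \<beta>} * q ^ ((r - s) * k)"
      by (rule card_nil_extensions[OF d1 K0 C1])
    thus ?thesis unfolding card_nil[OF C1] .
  qed
  finally show ?thesis by (simp add: power_add)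
qed

end

text \<open>With \<open>a k = q^(k(k-1)) / |GL(k,q)|\<close>, \<open>strata a n m\<close> is the number of commuting nilpotent pairs
  \<open>(A, B)\<close> in dimension \<open>n\<close> with \<open>dim ker A = m\<close>, divided by \<open>|GL(n,q)|\<close>.\<close>

function strata :: "(nat \<Rightarrow> real) \<Rightarrow> nat \<Rightarrow> nat \<Rightarrow> real" where
  "strata a n m = (if m = 0 then if n = 0 then 1 else 0 else if m > n then 0
     else \<Sum>m'\<le>m. strata a (n - m) m' * a (m - m'))"
  by pat_completeness auto
termination by (relation "Wellfounded.measure (\<lambda>(a, n, m). n)") auto

declare strata.simps [simp del]

lemma strata_gt: "m > n \<Longrightarrow> strata a n m = 0"
  by (subst strata.simps) simp

section \<open>The recursion for the normalised counts\<close>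

context finite_field_space
begin

lemma frames_pos: "d \<le> n \<Longrightarrow> frames n d > 0"
  unfolding frames_def using q_ge_2 by (intro prod_pos) auto

text \<open>Pulling q^r out of each of the last \<open>m\<close> factors leaves
  \<open>frames m m\<close>; the cofactor of \<open>frames (r + m) r\<close> counts the completions
  of \<open>r\<close> independent vectors to a basis.\<close>

lemma frames_split: "frames (r + m) (r + m) = frames (r + m) r * real q ^ (r * m) * frames m m"
proof -
  have *: "(\<Prod>j<r + m. f j) = (\<Prod>j<r. f j) * (\<Prod>i<m. f (r + i))" for f :: "nat \<Rightarrow> real"
    by (induction m) (auto simp: mult.assoc)
  have "(\<Prod>i<m. real q ^ (r + m) - real q ^ (r + i)) = (\<Prod>i<m. real q ^ r * (real q ^ m - real q ^ i))"
    by (simp add: algebra_simps power_add)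
  also have "\<dots> = real q ^ (r * m) * frames m m" by (simp add: prod.distrib frames_def power_mult)
  finally show ?thesis unfolding frames_def[of "r + m"] * by (simp add: mult.assoc)
qed

definition weight :: "nat \<Rightarrow> real" where
  "weight k = real q ^ (k * (k - 1)) / frames k k"

definition commuting_nilpotents :: "'v set \<Rightarrow> (('v \<Rightarrow> 'v) \<times> ('v \<Rightarrow> 'v)) set" where
  "commuting_nilpotents V = {(A, B). A \<in> lin_maps V V \<and> B \<in> lin_maps V V \<and> nilpotent_on V A \<and> nilpotent_on V B \<and> (\<forall>x\<in>V. A (B x) = B (A x))}"

definition commuting_nilpotents_rank :: "'v set \<Rightarrow> nat \<Rightarrow> (('v \<Rightarrow> 'v) \<times> ('v \<Rightarrow> 'v)) set" where
  "commuting_nilpotents_rank V s = {p \<in> commuting_nilpotents V. has_dim (fst p ` V) s}"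

lemma finite_commuting_nilpotents: "finite V \<Longrightarrow> finite (commuting_nilpotents V)"
  by (rule finite_subset[of _ "lin_maps V V \<times> lin_maps V V"]) (auto simp: commuting_nilpotents_def lin_finite)

lemma sum_commuting_nilpotents_by_rank:
  assumes "has_dim V n"
  shows "(\<Sum>p\<in>commuting_nilpotents V. h p) = (\<Sum>m\<le>n. \<Sum>p\<in>commuting_nilpotents_rank V (n - m). h p)"
proof -
  have ex: "\<exists>m\<in>{..n}. has_dim (A ` V) (n - m)" if "A \<in> lin_maps V V" for A
  proof -
    have s: "subspace (A ` V)" "A ` V \<subseteq> V"
      using lin_image_subspace[OF that has_dim_subspace[OF assms]] lin_in[OF that] by auto
    obtain e where e: "has_dim (A ` V) e" using has_dim_exists[OF s(1)] has_dim_finite[OF assms] by blast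
    thus ?thesis using has_dim_mono[OF assms e s(2)] by (intro bexI[of _ "n - e"]) simp_all
  qed
  have "commuting_nilpotents V = (\<Union>m\<in>{..n}. commuting_nilpotents_rank V (n - m))"
  proof (intro equalityI subsetI)
    fix p assume p: "p \<in> commuting_nilpotents V"
    hence "fst p \<in> lin_maps V V" by (auto simp: commuting_nilpotents_def)
    from ex[OF this] show "p \<in> (\<Union>m\<in>{..n}. commuting_nilpotents_rank V (n - m))" using p by (simp add: commuting_nilpotents_rank_def)
  qed (simp add: commuting_nilpotents_rank_def)
  moreover have "(\<Sum>p\<in>(\<Union>m\<in>{..n}. commuting_nilpotents_rank V (n - m)). h p) = (\<Sum>m\<le>n. \<Sum>p\<in>commuting_nilpotents_rank V (n - m). h p)"
  proof (rule sum.UNION_disjoint)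
    show "\<forall>i\<in>{..n}. \<forall>j\<in>{..n}. i \<noteq> j \<longrightarrow> commuting_nilpotents_rank V (n - i) \<inter> commuting_nilpotents_rank V (n - j) = {}"
      by (auto simp: commuting_nilpotents_rank_def dest: has_dim_unique)
  qed (auto simp: commuting_nilpotents_rank_def finite_commuting_nilpotents has_dim_finite[OF assms])
  ultimately show ?thesis by simp
qed

text \<open>The number of extensions of one pair (a, b) from dimension \<open>r\<close> to dimension
  \<open>r + m\<close>, with image of dimension \<open>r\<close> and dim ker a = \<open>j\<close>.
  The first line counts \<open>A\<close> (\<open>card_extensions_onto\<close> with
  \<open>s = r - j\<close>), the second counts \<open>B\<close>
  (\<open>card_commuting_nil_extensions\<close> with \<open>k = m - j\<close>). For
  \<open>j > m\<close> the factor \<open>frames m j\<close> is 0.\<close>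

definition ext_count :: "nat \<Rightarrow> nat \<Rightarrow> nat \<Rightarrow> real" where
  "ext_count r m j = real q ^ (m * (r - j)) * frames m j *
     real q ^ ((m - j) * (m - j - 1) + j * (m - j) + m * j)"

lemma frames_zero: "n < d \<Longrightarrow> frames n d = 0"
  unfolding frames_def by (rule prod_zero) auto

text \<open>Nilpotency of \<open>A\<close> is automatic, since A^(i+1) is a^i after A. It remains to
  choose \<open>A\<close> onto \<open>W\<close> and then \<open>B\<close>, and both counts depend
  only on dimensions.\<close>

lemma card_pair_extensions:
  assumes V: "has_dim V n" and W: "has_dim W r" "W \<subseteq> V" and ab: "(a, b) \<in> commuting_nilpotents_rank W (r - j)" and j: "j \<le> r"
  shows "real (card {p \<in> commuting_nilpotents V. fst p ` V = W \<and> (restrict (fst p) W, restrict (snd p) W) = (a, b)}) =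
    ext_count r (n - r) j"
proof -
  note sV = has_dim_subspace[OF V] and sW = has_dim_subspace[OF W(1)]
  have a: "a \<in> lin_maps W W" "nilpotent_on W a" and b: "b \<in> lin_maps W W" "nilpotent_on W b"
    and com: "\<And>x. x \<in> W \<Longrightarrow> a (b x) = b (a x)" and s: "has_dim (a ` W) (r - j)"
    using ab by (auto simp: commuting_nilpotents_rank_def commuting_nilpotents_def)
  define SA where "SA = {A \<in> lin_maps V V. (\<forall>x\<in>W. A x = a x) \<and> A ` V = W}"
  define SB where "SB A = {B \<in> lin_maps V V. (\<forall>x\<in>W. B x = b x) \<and> (\<forall>x\<in>V. A (B x) = B (A x)) \<and> nilpotent_on V B}" for A
  have nilA: "nilpotent_on V A" if A: "A \<in> SA" for A
  proof -
    obtain i where i: "\<And>x. x \<in> W \<Longrightarrow> (a ^^ i) x = 0" using a(2) by (auto simp: nilpotent_on_def)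
    have "(A ^^ Suc i) x = 0" if x: "x \<in> V" for x
    proof -
      have "A x \<in> W" using A x by (auto simp: SA_def)
      hence "(A ^^ i) (A x) = (a ^^ i) (A x)"
        using funpow_cong[of W a A "A x" i] lin_in[OF a(1)] A by (auto simp: SA_def)
      thus ?thesis using i \<open>A x \<in> W\<close> by (simp add: funpow_swap1)
    qed
    thus ?thesis unfolding nilpotent_on_def by blast
  qed
  have ra: "restrict A W = a \<longleftrightarrow> (\<forall>x\<in>W. A x = a x)" if "A \<in> lin_maps V V" "a \<in> lin_maps W W" for A a
  proof
    assume "\<forall>x\<in>W. A x = a x"
    thus "restrict A W = a" by (intro lin_eqI[OF lin_restrict[OF that(1) W(2) sW] that(2)]) auto
  qed auto
  have "{p \<in> commuting_nilpotents V. fst p ` V = W \<and> (restrict (fst p) W, restrict (snd p) W) = (a, b)} = (SIGMA A:SA. SB A)"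
  proof (intro equalityI subsetI)
    fix p assume p: "p \<in> {p \<in> commuting_nilpotents V. fst p ` V = W \<and> (restrict (fst p) W, restrict (snd p) W) = (a, b)}"
    obtain A B where AB: "p = (A, B)" by fastforce
    have "A \<in> lin_maps V V" "B \<in> lin_maps V V" "restrict A W = a" "restrict B W = b" using p AB by (auto simp: commuting_nilpotents_def)
    hence "\<forall>x\<in>W. A x = a x" "\<forall>x\<in>W. B x = b x" using ra a b by blast+
    thus "p \<in> (SIGMA A:SA. SB A)" using p AB by (simp add: commuting_nilpotents_def SA_def SB_def)
  next
    fix p assume p: "p \<in> (SIGMA A:SA. SB A)"
    obtain A B where AB: "p = (A, B)" by fastforce
    hence m: "A \<in> SA" "B \<in> SB A" using p by auto
    hence "restrict A W = a" "restrict B W = b" using ra[of A a] ra[of B b] a b by (auto simp: SA_def SB_def)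
    thus "p \<in> {p \<in> commuting_nilpotents V. fst p ` V = W \<and> (restrict (fst p) W, restrict (snd p) W) = (a, b)}"
      using m nilA[OF m(1)] AB by (simp add: commuting_nilpotents_def SA_def SB_def)
  qed
  also have "card \<dots> = (\<Sum>A\<in>SA. card (SB A))"
    by (rule card_SigmaI) (auto simp: SA_def SB_def lin_finite has_dim_finite[OF V])
  finally have c: "card {p \<in> commuting_nilpotents V. fst p ` V = W \<and> (restrict (fst p) W, restrict (snd p) W) = (a, b)} =
    (\<Sum>A\<in>SA. card (SB A))" .
  have cA: "real (card SA) = real q ^ ((n - r) * (r - j)) * frames (n - r) j"
    using card_extensions_onto[OF V W a(1) s] j by (simp add: SA_def)
  show ?thesis
  proof (cases "j \<le> n - r")
    case True
    have "card (SB A) = q ^ ((n - r - j) * (n - r - j - 1) + j * (n - r - j) + (n - r) * j)" if A: "A \<in> SA" for A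
    proof -
      have A': "A \<in> lin_maps V V" "A ` V = W" "\<And>x. x \<in> W \<Longrightarrow> A x = a x" using A by (auto simp: SA_def)
      have "A ` W = a ` W" using A'(3) by (simp cong: image_cong)
      hence s': "has_dim (A ` W) (r - j)" using s by simp
      have "A (b x) = b (A x)" if "x \<in> W" for x
        using com[OF that] A'(3) that lin_in[OF b(1) that] by simp
      moreover have kk: "n - r = n - r - j + (r - (r - j))" and rj: "r - (r - j) = j" using True j by simp_all
      ultimately have "card {B \<in> lin_maps V V. (\<forall>x\<in>W. B x = b x) \<and> (\<forall>x\<in>V. A (B x) = B (A x)) \<and> nilpotent_on V B} =
        q ^ ((n - r - j) * (n - r - j - 1) + (r - (r - j)) * (n - r - j) + (n - r) * (r - (r - j)))"
        by (intro card_commuting_nil_extensions[OF V A'(1,2) W(1) s' b])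
      thus ?thesis by (simp only: rj SB_def)
    qed
    hence "real (\<Sum>A\<in>SA. card (SB A)) =
      real (card SA) * real q ^ ((n - r - j) * (n - r - j - 1) + j * (n - r - j) + (n - r) * j)" by simp
    thus ?thesis unfolding c cA ext_count_def .
  next
    \<comment> \<open>If dim ker a exceeds \<open>n - r\<close>, no extension \<open>A\<close> maps
      onto \<open>W\<close>, and both sides are 0.\<close>
    case False
    hence "card SA = 0" using cA by (simp add: frames_zero)
    moreover have "finite SA" by (simp add: SA_def lin_finite has_dim_finite[OF V])
    ultimately have "SA = {}" by simp
    thus ?thesis unfolding c using False by (simp add: ext_count_def frames_zero)
  qed
qed

text \<open>Both maps preserve \<open>W\<close>, the image of \<open>A\<close>: for \<open>B\<close>
  because B(A v) = A(B v). The pairs are sorted by their restrictions, and \<open>j\<close> is the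
  nullity of the restricted \<open>A\<close>.\<close>

lemma card_commuting_nilpotents_image:
  assumes V: "has_dim V n" and W: "has_dim W r" "W \<subseteq> V"
  shows "real (card {p \<in> commuting_nilpotents_rank V r. fst p ` V = W}) =
    (\<Sum>j\<le>r. real (card (commuting_nilpotents_rank W (r - j))) * ext_count r (n - r) j)"
proof -
  let ?\<rho> = "\<lambda>p. (restrict (fst p) W, restrict (snd p) W)"
  define S where "S = {p \<in> commuting_nilpotents V. fst p ` V = W}"
  have SW: "{p \<in> commuting_nilpotents_rank V r. fst p ` V = W} = S" using W by (auto simp: S_def commuting_nilpotents_rank_def)
  note sW = has_dim_subspace[OF W(1)]
  have "card S = (\<Sum>w\<in>commuting_nilpotents W. card {p \<in> S. ?\<rho> p = w})"
  proof (rule card_by_value)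
    fix p assume p: "p \<in> S"
    obtain A B where AB: "p = (A, B)" by fastforce
    hence A: "A \<in> lin_maps V V" "A ` V = W" "nilpotent_on V A" and B: "B \<in> lin_maps V V" "nilpotent_on V B"
      and com: "\<And>x. x \<in> V \<Longrightarrow> A (B x) = B (A x)" using p by (auto simp: S_def commuting_nilpotents_def)
    have AW: "A x \<in> W" if "x \<in> W" for x using that A(2) W(2) by blast
    have BW: "B x \<in> W" if x: "x \<in> W" for x
    proof -
      obtain v where v: "v \<in> V" "x = A v" using x A(2) by blast
      hence "B x = A (B v)" using com by simp
      thus ?thesis using v lin_in[OF B(1)] A(2) by blast
    qed
    have "restrict A W \<in> lin_maps W W" "restrict B W \<in> lin_maps W W"
      using lin_codomain[OF lin_restrict[OF A(1) W(2) sW]] lin_codomain[OF lin_restrict[OF B(1) W(2) sW]]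
        AW BW by auto
    moreover have "nilpotent_on W (restrict A W)" by (rule nil_restrict[OF A(3) W(2) AW]) auto
    moreover have "nilpotent_on W (restrict B W)" by (rule nil_restrict[OF B(2) W(2) BW]) auto
    ultimately show "?\<rho> p \<in> commuting_nilpotents W" using com AW BW W(2) by (auto simp: AB commuting_nilpotents_def)
  qed (simp_all add: S_def finite_commuting_nilpotents has_dim_finite[OF V] has_dim_finite[OF W(1)])
  hence "real (card S) = (\<Sum>w\<in>commuting_nilpotents W. real (card {p \<in> S. ?\<rho> p = w}))" by simp
  also have "\<dots> = (\<Sum>j\<le>r. \<Sum>w\<in>commuting_nilpotents_rank W (r - j). real (card {p \<in> S. ?\<rho> p = w}))"
    by (rule sum_commuting_nilpotents_by_rank[OF W(1)])
  also have "\<dots> = (\<Sum>j\<le>r. \<Sum>w\<in>commuting_nilpotents_rank W (r - j). ext_count r (n - r) j)"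
  proof (intro sum.cong refl)
    fix j w assume j: "j \<in> {..r}" and w: "w \<in> commuting_nilpotents_rank W (r - j)"
    obtain a b where ab: "w = (a, b)" by fastforce
    have "{p \<in> S. ?\<rho> p = w} = {p \<in> commuting_nilpotents V. fst p ` V = W \<and> ?\<rho> p = (a, b)}" by (auto simp: S_def ab)
    thus "real (card {p \<in> S. ?\<rho> p = w}) = ext_count r (n - r) j"
      using card_pair_extensions[OF V W, of a b j] w j ab by simp
  qed
  finally show ?thesis by (simp add: SW)
qed

text \<open>The cancellation behind the recursion: once both group orders are expanded by
  \<open>frames_split\<close>, the powers of \<open>q\<close> agree because rm = m(r-j) +
  mj.\<close>

lemma ext_count_weight:
  assumes "j \<le> m" "j \<le> r"
  shows "frames (r + m) r * ext_count r m j = frames (r + m) (r + m) * weight (m - j)"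
proof -
  obtain k where k: "m = j + k" using assms le_Suc_ex by blast
  obtain s where s: "r = j + s" using assms le_Suc_ex by blast
  have f: "frames k k \<noteq> 0" using frames_pos[of k k] by simp
  have "frames m m = frames m j * real q ^ (j * k) * frames k k" using frames_split[of j k] by (simp add: k)
  moreover have "m - j = k" by (simp add: k)
  ultimately have "frames (r + m) (r + m) * weight (m - j) =
      frames (r + m) r * frames m j * (real q ^ (r * m) * real q ^ (j * k) * real q ^ (k * (k - 1)))"
    using f by (simp add: frames_split[of r m] weight_def)
  also have "real q ^ (r * m) * real q ^ (j * k) * real q ^ (k * (k - 1)) =
      real q ^ (m * (r - j)) * real q ^ (k * (k - 1) + j * k + m * j)"
    unfolding power_add[symmetric] by (rule arg_cong[of _ _ "\<lambda>e. real q ^ e"], cases k) (simp_all add: s k algebra_simps)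
  finally show ?thesis by (simp add: ext_count_def k)
qed

text \<open>Strong induction on \<open>n\<close>, the pairs being sorted by the image of
  \<open>A\<close>. For \<open>n > 0\<close> and \<open>m = 0\<close> there are none, as a nilpotent
  map is not onto a nonzero space.\<close>

lemma card_commuting_nilpotents_rank:
  assumes "has_dim V n" "m \<le> n"
  shows "real (card (commuting_nilpotents_rank V (n - m))) = frames n n * strata weight n m"
  using assms
proof (induction n arbitrary: V m rule: less_induct)
  case (less n)
  note V = less.prems(1)
  note sV = has_dim_subspace[OF V] and fV = has_dim_finite[OF V]
  consider "n = 0" | "n > 0" "m = 0" | "n > 0" "m > 0" by blast
  thus ?case
  proof cases
    case 1
    let ?z = "\<lambda>x\<in>{0::'v}. 0 :: 'v"
    have V0: "V = {0}" using V 1 by (simp add: has_dim_0)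
    have l: "lin_maps {0} {0} = {?z}" by (rule lin_from_zero) simp
    have "nilpotent_on {0} ?z" unfolding nilpotent_on_def by (rule exI[of _ 0]) simp
    hence "commuting_nilpotents_rank V 0 = {(?z, ?z)}" by (auto simp: commuting_nilpotents_rank_def commuting_nilpotents_def V0 l has_dim_0)
    thus ?thesis using 1 less.prems(2) by (simp add: frames_def strata.simps)
  next
    case 2
    have "commuting_nilpotents_rank V n = {}"
    proof (rule ccontr)
      assume "commuting_nilpotents_rank V n \<noteq> {}"
      then obtain A B where AB: "(A, B) \<in> commuting_nilpotents_rank V n" by fastforce
      hence A: "A \<in> lin_maps V V" "nilpotent_on V A" "has_dim (A ` V) n" by (auto simp: commuting_nilpotents_rank_def commuting_nilpotents_def)
      have "A ` V = V" using has_dim_eq[OF V A(3)] lin_in[OF A(1)] by blast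
      hence "V = {0}" using nil_image_proper[OF A(2) _ sV] by simp
      hence "n = 0" using V has_dim_0 has_dim_unique by blast
      thus False using 2 by simp
    qed
    thus ?thesis using 2 by (simp add: strata.simps)
  next
    case 3
    define r where "r = n - m"
    have n: "n = r + m" using less.prems(2) by (simp add: r_def)
    have r: "r < n" "r \<le> n" "n - r = m" using 3 n by auto
    define T where "T = {W. has_dim W r \<and> W \<subseteq> V}"
    have "card (commuting_nilpotents_rank V r) = (\<Sum>W\<in>T. card {p \<in> commuting_nilpotents_rank V r. fst p ` V = W})"
    proof (rule card_by_value)
      show "finite T" unfolding T_def using fV by (auto intro: finite_subset[of _ "Pow V"])
      fix p assume "p \<in> commuting_nilpotents_rank V r"
      thus "fst p ` V \<in> T" by (auto simp: commuting_nilpotents_rank_def commuting_nilpotents_def T_def lin_in)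
    qed (simp add: commuting_nilpotents_rank_def finite_commuting_nilpotents[OF fV])
    also have "real \<dots> = (\<Sum>W\<in>T. \<Sum>j\<le>r. frames r r * strata weight r j * ext_count r m j)"
      unfolding of_nat_sum
    proof (intro sum.cong refl)
      fix W assume W: "W \<in> T"
      show "real (card {p \<in> commuting_nilpotents_rank V r. fst p ` V = W}) = (\<Sum>j\<le>r. frames r r * strata weight r j * ext_count r m j)"
        using card_commuting_nilpotents_image[OF V, of W r] less.IH[OF r(1), of W] W by (simp add: T_def r)
    qed
    also have "\<dots> = real (card T) * frames r r * (\<Sum>j\<le>r. strata weight r j * ext_count r m j)"
      by (simp add: sum_distrib_left mult.assoc)
    \<comment> \<open>The group order from the induction hypothesis and the number of images combine
      into the factor with which \<open>ext_count_weight\<close> starts.\<close>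
    also have "real (card T) * frames r r = frames n r"
      using card_subspaces[OF V r(2)] by (simp add: T_def)
    \<comment> \<open>Terms with \<open>j > m\<close> vanish because \<open>ext_count\<close> does.
      Afterwards the range is enlarged to \<open>j \<le> m\<close>, and there \<open>strata\<close>
      vanishes for \<open>j > r\<close>.\<close>
    also have "(\<Sum>j\<le>r. strata weight r j * ext_count r m j) = (\<Sum>j\<in>{..min r m}. strata weight r j * ext_count r m j)"
      by (rule sum.mono_neutral_right) (auto simp: ext_count_def frames_zero)
    also have "frames n r * \<dots> = (\<Sum>j\<in>{..min r m}. frames n n * (strata weight r j * weight (m - j)))"
      unfolding sum_distrib_left
      by (intro sum.cong refl) (use ext_count_weight[of _ m r] in \<open>simp add: n mult.left_commute\<close>)
    also have "\<dots> = frames n n * (\<Sum>j\<in>{..min r m}. strata weight r j * weight (m - j))"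
      by (simp add: sum_distrib_left)
    also have "(\<Sum>j\<in>{..min r m}. strata weight r j * weight (m - j)) = (\<Sum>j\<le>m. strata weight r j * weight (m - j))"
      by (rule sum.mono_neutral_left) (auto simp: strata_gt)
    also have "\<dots> = strata weight n m"
      using 3 less.prems(2) by (simp add: strata.simps[of weight n m] r_def)
    finally show ?thesis by (simp add: r_def)
  qed
qed

lemma card_commuting_nilpotents:
  assumes "has_dim V n"
  shows "real (card (commuting_nilpotents V)) = frames n n * (\<Sum>m\<le>n. strata weight n m)"
proof -
  have "real (card (commuting_nilpotents V)) = (\<Sum>m\<le>n. real (card (commuting_nilpotents_rank V (n - m))))"
    using sum_commuting_nilpotents_by_rank[OF assms, of "\<lambda>_. 1 :: real"] by simp
  thus ?thesis using card_commuting_nilpotents_rank[OF assms] by (simp add: sum_distrib_left)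
qed

end

section \<open>Generating functions\<close>

text \<open>The power series with coefficients \<open>c\<close>, evaluated at u^i.\<close>

definition dilate :: "nat \<Rightarrow> (nat \<Rightarrow> real) \<Rightarrow> real fps" where
  "dilate i c = Abs_fps (\<lambda>n. if i dvd n then c (n div i) else 0)"

lemma dilate_mult_nth:
  assumes "i > 0"
  shows "fps_nth (dilate i c * F) n = (\<Sum>j\<in>{j. i * j \<le> n}. c j * fps_nth F (n - i * j))"
proof -
  have "fps_nth (dilate i c * F) n = (\<Sum>k\<in>{0..n}. if i dvd k then c (k div i) * fps_nth F (n - k) else 0)"
    unfolding fps_mult_nth dilate_def by (intro sum.cong) auto
  also have "\<dots> = (\<Sum>k\<in>{k\<in>{0..n}. i dvd k}. c (k div i) * fps_nth F (n - k))"
    by (rule sum.inter_filter[symmetric]) simp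
  also have "\<dots> = (\<Sum>j\<in>{j. i * j \<le> n}. c j * fps_nth F (n - i * j))"
    by (rule sum.reindex_bij_witness[of _ "\<lambda>j. i * j" "\<lambda>k. k div i"]) (use assms in auto)
  finally show ?thesis .
qed

text \<open>The series G_k, with the stratum of size \<open>n - k * m\<close> and nullity
  \<open>m\<close> placed in degree \<open>n\<close>. The bound \<open>k * m \<le> n\<close> guards
  the natural subtraction, and \<open>m \<le> n\<close> keeps the index set finite for
  \<open>k = 0\<close>.\<close>

definition strata_fps :: "(nat \<Rightarrow> real) \<Rightarrow> nat \<Rightarrow> real fps" where
  "strata_fps a k = Abs_fps (\<lambda>n. \<Sum>m\<in>{m. k * m \<le> n \<and> m \<le> n}. strata a (n - k * m) m)"

text \<open>The recursion for \<open>strata\<close>, with \<open>u^m\<close> absorbed into the shift of \<open>k\<close>.\<close>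

lemma strata_fps_step:
  assumes a0: "a 0 = 1"
  shows "strata_fps a k = dilate (Suc k) a * strata_fps a (Suc k)"
proof (rule fps_ext)
  fix n
  let ?K = "Suc k"
  have fin: "finite {m. ?K * m \<le> b}" for b by (rule finite_subset[of _ "{..b}"]) auto
  have "fps_nth (strata_fps a k) n = (\<Sum>m\<in>{m. k * m \<le> n \<and> m \<le> n}. strata a (n - k * m) m)"
    by (simp add: strata_fps_def)
  \<comment> \<open>If \<open>k * m \<le> n\<close> but \<open>?K * m > n\<close>, then
    \<open>m > n - k * m\<close> and the stratum is 0.\<close>
  also have "\<dots> = (\<Sum>m\<in>{m. ?K * m \<le> n}. strata a (n - k * m) m)"
    by (rule sum.mono_neutral_right) (auto intro!: strata_gt)
  also have "\<dots> = (\<Sum>m\<in>{m. ?K * m \<le> n}. \<Sum>m'\<le>m. strata a (n - ?K * m) m' * a (m - m'))"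
  proof (intro sum.cong refl)
    fix m assume m: "m \<in> {m. ?K * m \<le> n}"
    show "strata a (n - k * m) m = (\<Sum>m'\<le>m. strata a (n - ?K * m) m' * a (m - m'))"
    proof (cases "m = 0")
      \<comment> \<open>At \<open>m = 0\<close> the function \<open>strata\<close> has a boundary
        value instead of the recursion; the summed form still holds there because
        \<open>a 0 = 1\<close>.\<close>
      case True thus ?thesis using a0 by simp
    next
      case False
      moreover have "n - k * m - m = n - ?K * m" "\<not> m > n - k * m" using m by auto
      ultimately show ?thesis by (subst strata.simps) simp
    qed
  qed
  also have "\<dots> = (\<Sum>(m, m')\<in>(SIGMA m:{m. ?K * m \<le> n}. {..m}). strata a (n - ?K * m) m' * a (m - m'))"
    by (rule sum.Sigma) (use fin in auto)
  \<comment> \<open>With j = m - m' the degree splits: \<open>?K * j\<close> goes to the new factor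
    and \<open>?K * m'\<close> stays in the next series.\<close>
  also have "\<dots> = (\<Sum>(j, m')\<in>(SIGMA j:{j. ?K * j \<le> n}. {m'. ?K * m' \<le> n - ?K * j}).
      a j * strata a (n - ?K * j - ?K * m') m')"
  proof (rule sum.reindex_bij_witness[of _ "\<lambda>(j, m'). (j + m', m')" "\<lambda>(m, m'). (m - m', m')"])
    fix x assume "x \<in> (SIGMA m:{m. ?K * m \<le> n}. {..m})"
    then obtain j m' where x: "x = (j + m', m')" "?K * j + ?K * m' \<le> n"
      by (auto simp: add_mult_distrib2[symmetric] simp del: mult_Suc) (metis le_add_diff_inverse2)
    show "(case case x of (m, m') \<Rightarrow> (m - m', m') of (j, m') \<Rightarrow> (j + m', m')) = x" using x by simp
    show "(case x of (m, m') \<Rightarrow> (m - m', m')) \<in> (SIGMA j:{j. ?K * j \<le> n}. {m'. ?K * m' \<le> n - ?K * j})"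
      using x by simp
    show "(case case x of (m, m') \<Rightarrow> (m - m', m') of (j, m') \<Rightarrow> a j * strata a (n - ?K * j - ?K * m') m') =
        (case x of (m, m') \<Rightarrow> strata a (n - ?K * m) m' * a (m - m'))"
    proof -
      have e: "n - ?K * (j + m') = n - ?K * j - ?K * m'" by (simp add: add_mult_distrib2 del: mult_Suc)
      show ?thesis unfolding x(1) prod.case add_diff_cancel_right' e by (rule mult.commute)
    qed
  qed (auto simp: add_mult_distrib2)
  also have "\<dots> = (\<Sum>j\<in>{j. ?K * j \<le> n}. \<Sum>m'\<in>{m'. ?K * m' \<le> n - ?K * j}. a j * strata a (n - ?K * j - ?K * m') m')"
    by (rule sum.Sigma[symmetric]) (use fin in auto)
  also have "\<dots> = (\<Sum>j\<in>{j. ?K * j \<le> n}. a j * fps_nth (strata_fps a ?K) (n - ?K * j))"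
  proof (intro sum.cong refl)
    fix j
    have "{m'. ?K * m' \<le> b \<and> m' \<le> b} = {m'. ?K * m' \<le> b}" for b by auto
    thus "(\<Sum>m'\<in>{m'. ?K * m' \<le> n - ?K * j}. a j * strata a (n - ?K * j - ?K * m') m') =
        a j * fps_nth (strata_fps a ?K) (n - ?K * j)"
      by (simp only: strata_fps_def fps_nth_Abs_fps sum_distrib_left)
  qed
  also have "\<dots> = fps_nth (dilate ?K a * strata_fps a ?K) n"
    by (rule dilate_mult_nth[symmetric]) simp
  finally show "fps_nth (strata_fps a k) n = fps_nth (dilate ?K a * strata_fps a ?K) n" .
qed

text \<open>Only \<open>m = 0\<close> contributes below degree \<open>k\<close>.\<close>

lemma strata_fps_nth_small:
  assumes "n < k"
  shows "fps_nth (strata_fps a k) n = (if n = 0 then 1 else 0)"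
proof -
  have "{m. k * m \<le> n \<and> m \<le> n} = {0}"
  proof -
    have "m = 0" if "k * m \<le> n" for m
      using that assms by (cases m) auto
    thus ?thesis by auto
  qed
  thus ?thesis by (simp add: strata_fps_def strata.simps)
qed

text \<open>After \<open>N\<close> steps the remainder is \<open>strata_fps a N\<close>, which does
  not affect the coefficient \<open>n\<close> once \<open>N > n\<close>.\<close>

lemma fps_has_infprod_dilate:
  assumes "a 0 = 1"
  shows "fps_has_infprod (\<lambda>i. dilate i a) (strata_fps a 0)"
  unfolding fps_has_infprod_def
proof
  fix n
  have *: "strata_fps a 0 = (\<Prod>i=1..N. dilate i a) * strata_fps a N" for N
  proof (induction N)
    case (Suc N)
    thus ?case using strata_fps_step[of a N] assms by (simp add: mult.assoc)
  qed simp
  have "fps_nth (\<Prod>i=1..N. dilate i a) n = fps_nth (strata_fps a 0) n" if "N > n" for N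
  proof -
    have "fps_nth (strata_fps a 0) n =
        (\<Sum>i=0..n. fps_nth (\<Prod>i=1..N. dilate i a) i * fps_nth (strata_fps a N) (n - i))"
      by (subst *[of N]) (simp add: fps_mult_nth)
    also have "\<dots> = (\<Sum>i=0..n. if i = n then fps_nth (\<Prod>i=1..N. dilate i a) i else 0)"
      using that by (intro sum.cong) (auto simp: strata_fps_nth_small)
    finally show ?thesis by simp
  qed
  thus "(\<lambda>N. fps_nth (\<Prod>i=1..N. dilate i a) n) \<longlonglongrightarrow> fps_nth (strata_fps a 0) n"
    by (intro tendsto_eventually eventually_mono[OF eventually_gt_at_top[of n]])
qed

section \<open>Euler's q-series identity\<close>

text \<open>The coefficient of \<open>x^k\<close> in the finite product of \<open>1 / (1 - p^l x)\<close> over \<open>l = 1..N\<close>.\<close>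

definition euler_partial :: "real \<Rightarrow> nat \<Rightarrow> nat \<Rightarrow> real" where
  "euler_partial p N k = p ^ k * (\<Prod>j<k. (1 - p ^ (N + j)) / (1 - p ^ Suc j))"

text \<open>This is multiplication by 1 - p^(N+1) x, read on coefficients. With common factors
  removed and denominators cleared it says p(1 - p^(N+1+k)) - p^(N+1)(1 - p^(k+1)) = p(1 -
  p^N).\<close>

lemma euler_partial_Suc:
  assumes p: "0 < p" "p < 1"
  shows "euler_partial p (Suc N) (Suc k) - p ^ Suc N * euler_partial p (Suc N) k = euler_partial p N (Suc k)"
proof -
  define C where "C = (\<Prod>j<k. (1 - p ^ (Suc N + j)))"
  define D where "D = (\<Prod>j<k. (1 - p ^ Suc j))"
  have pk: "1 - p ^ Suc j \<noteq> 0" for j using power_Suc_less_one[OF p, of j] by simp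
  have D: "D \<noteq> 0" unfolding D_def using pk by (simp add: prod_zero_iff del: power_Suc)
  have "euler_partial p (Suc N) k = p ^ k * (C / D)"
    by (simp add: euler_partial_def C_def D_def prod_dividef)
  note e1 = this
  have "euler_partial p (Suc N) (Suc k) = p ^ Suc k * (C * (1 - p ^ (Suc N + k)) / (D * (1 - p ^ Suc k)))"
    by (simp add: euler_partial_def C_def D_def prod_dividef)
  note e2 = this
  have "euler_partial p N (Suc k) = p ^ Suc k * ((1 - p ^ N) * C / (D * (1 - p ^ Suc k)))"
  proof -
    have "(\<Prod>j<Suc k. 1 - p ^ (N + j)) = (1 - p ^ N) * C"
      unfolding C_def by (subst prod.lessThan_Suc_shift) simp
    moreover have "(\<Prod>j<Suc k. 1 - p ^ Suc j) = D * (1 - p ^ Suc k)" by (simp add: D_def)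
    ultimately show ?thesis unfolding euler_partial_def prod_dividef by metis
  qed
  note e3 = this
  show ?thesis unfolding e1 e2 e3 using D pk[of k] p by (simp add: divide_simps) (simp add: algebra_simps power_add)
qed

lemma dilate_euler_partial_step:
  assumes p: "0 < p" "p < 1" and i: "i > 0"
  shows "dilate i (euler_partial p (Suc N)) * (1 - fps_const (p ^ Suc N) * fps_X ^ i) = dilate i (euler_partial p N)"
proof (rule fps_ext)
  fix n
  let ?h = "euler_partial p"
  have "fps_nth (dilate i (?h (Suc N)) * (1 - fps_const (p ^ Suc N) * fps_X ^ i)) n =
     fps_nth (dilate i (?h (Suc N))) n - p ^ Suc N * fps_nth (dilate i (?h (Suc N)) * fps_X ^ i) n"
  proof -
    have "F * (1 - fps_const c * fps_X ^ i) = F - fps_const c * (F * fps_X ^ i)" for F :: "real fps" and c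
      by (simp add: algebra_simps)
    thus ?thesis by (simp only: fps_sub_nth fps_mult_left_const_nth)
  qed
  also have "\<dots> = fps_nth (dilate i (?h N)) n"
  proof (cases "i dvd n")
    case False
    have "\<not> i dvd n - i" if "n \<ge> i" using False that by (simp add: dvd_diff_nat dvd_minus_self)
    thus ?thesis using False by (auto simp: dilate_def fps_X_power_mult_right_nth)
  next
    case True
    then obtain k where k: "n = i * k" by blast
    show ?thesis
    proof (cases k)
      case 0 thus ?thesis using i by (simp add: k dilate_def fps_X_power_mult_right_nth euler_partial_def)
    next
      case (Suc k')
      hence "n - i = i * k'" "n \<ge> i" by (simp_all add: k)
      hence "fps_nth (dilate i (?h (Suc N)) * fps_X ^ i) n = ?h (Suc N) k'"
        using i by (simp add: dilate_def fps_X_power_mult_right_nth)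
      moreover have "fps_nth (dilate i (?h M)) n = ?h M (Suc k')" for M
        using i by (simp add: dilate_def k Suc)
      ultimately show ?thesis using euler_partial_Suc[OF p] by simp
    qed
  qed
  finally show "fps_nth (dilate i (?h (Suc N)) * (1 - fps_const (p ^ Suc N) * fps_X ^ i)) n = fps_nth (dilate i (?h N)) n" .
qed

lemma euler_finite_product:
  assumes p: "0 < p" "p < 1" and i: "i > 0"
  shows "(\<Prod>l=1..N. 1 / (1 - fps_const (p ^ l) * fps_X ^ i)) = dilate i (euler_partial p N)"
proof (induction N)
  case 0
  \<comment> \<open>The factor \<open>j = 0\<close> is 1 - p^0 = 0, so only the empty product at
    \<open>k = 0\<close> survives.\<close>
  have "euler_partial p 0 k = (if k = 0 then 1 else 0)" for k
    by (auto simp: euler_partial_def intro!: prod_zero bexI[of _ 0])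
  thus ?case using i by (auto intro!: fps_ext simp: dilate_def dvd_div_eq_0_iff)
next
  case (Suc N)
  define Q :: "real fps" where "Q = 1 - fps_const (p ^ Suc N) * fps_X ^ i"
  have Q0: "fps_nth Q 0 \<noteq> 0" using i by (simp add: Q_def)
  have "(\<Prod>l=1..Suc N. 1 / (1 - fps_const (p ^ l) * fps_X ^ i)) = dilate i (euler_partial p N) * (1 / Q)"
    using Suc by (simp add: Q_def)
  also have "1 / Q = inverse Q" using Q0 by (simp add: fps_divide_unit)
  also have "dilate i (euler_partial p N) * inverse Q = dilate i (euler_partial p (Suc N)) * (Q * inverse Q)"
    using dilate_euler_partial_step[OF p i, of N] by (simp add: Q_def mult.assoc)
  also have "Q * inverse Q = 1" by (rule inverse_mult_eq_1'[OF Q0])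
  finally show ?case by simp
qed

text \<open>The coefficient of x^k in the product of 1 / (1 - p^l x) over all l \<ge> 1.\<close>

definition euler_coeff :: "real \<Rightarrow> nat \<Rightarrow> real" where
  "euler_coeff p k = p ^ k * (\<Prod>j<k. 1 / (1 - p ^ Suc j))"

text \<open>The numerators 1 - p^(N+j) tend to 1. For \<open>k > 0\<close> the coefficient changes
  with every \<open>N\<close>, so this is a limit of reals and not eventual constancy.\<close>

lemma euler_partial_tendsto:
  assumes p: "0 < p" "p < 1"
  shows "(\<lambda>N. euler_partial p N k) \<longlonglongrightarrow> euler_coeff p k"
proof -
  have "(\<lambda>N. (1 - p ^ (N + j)) / (1 - p ^ Suc j)) \<longlonglongrightarrow> (1 - 0) / (1 - p ^ Suc j)" for j
  proof (intro tendsto_intros)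
    show "(\<lambda>N. p ^ (N + j)) \<longlonglongrightarrow> 0"
      by (rule LIMSEQ_ignore_initial_segment) (use p LIMSEQ_realpow_zero in auto)
    show "1 - p ^ Suc j \<noteq> 0" using power_Suc_less_one[OF p, of j] by simp
  qed
  hence "(\<lambda>N. p ^ k * (\<Prod>j<k. (1 - p ^ (N + j)) / (1 - p ^ Suc j))) \<longlonglongrightarrow> p ^ k * (\<Prod>j<k. (1 - 0) / (1 - p ^ Suc j))"
    by (intro tendsto_mult tendsto_const tendsto_prod)
  thus ?thesis by (simp add: euler_partial_def euler_coeff_def)
qed

lemma fps_has_infprod_euler:
  assumes p: "0 < p" "p < 1" and i: "i > 0"
  shows "fps_has_infprod (\<lambda>l. 1 / (1 - fps_const (p ^ l) * fps_X ^ i)) (dilate i (euler_coeff p))"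
  unfolding fps_has_infprod_def euler_finite_product[OF assms]
  using euler_partial_tendsto[OF p] by (auto simp: dilate_def)

context finite_field_space
begin

text \<open>Both sides are 1 at \<open>k = 0\<close> and have the same ratio of consecutive terms,
  q^k / (q^(k+1) - 1).\<close>

lemma weight_eq_euler_coeff: "weight k = euler_coeff (1 / real q) k"
proof (induction k)
  case 0 show ?case by (simp add: weight_def euler_coeff_def frames_def)
next
  case (Suc k)
  have q: "real q > 1" using q_ge_2 by simp
  have fr: "frames (Suc k) (Suc k) = (real q ^ Suc k - 1) * real q ^ k * frames k k"
  proof -
    have "frames k (Suc k) = 0" by (rule frames_zero) simp
    thus ?thesis using frames_Suc[of k k] by simp
  qed
  have qk: "real q ^ Suc k - 1 > 0" using one_less_power[OF q, of "Suc k"] by simp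
  have pk: "1 - (1 / real q) ^ Suc k = (real q ^ Suc k - 1) / real q ^ Suc k"
    using q by (simp add: field_simps power_divide)
  have e: "Suc k * (Suc k - 1) = k * (k - 1) + k + k" by (cases k) (simp_all add: algebra_simps)
  have "weight (Suc k) = weight k * (real q ^ k / (real q ^ Suc k - 1))"
    unfolding weight_def fr e power_add using qk q frames_pos[of k k] by (simp add: field_simps)
  also have "real q ^ k / (real q ^ Suc k - 1) = (1 / real q) * (1 / (1 - (1 / real q) ^ Suc k))"
    unfolding pk using q qk by (simp add: field_simps)
  also have "weight k * \<dots> = euler_coeff (1 / real q) (Suc k)"
    unfolding Suc by (simp add: euler_coeff_def)
  finally show ?case .
qed

end

section \<open>Matrices as linear maps\<close>

interpretation vs: finite_field_space "\<lambda>(c::'a::{field,finite}) (f::nat \<Rightarrow> 'a) i. c * f i" "CARD('a)"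
  by unfold_locales (auto simp: fun_eq_iff algebra_simps)

text \<open>Types cannot depend on \<open>n\<close>, so F_q^n is realised inside the functions on
  all naturals, and one interpretation of the locale serves every \<open>n\<close>.\<close>

definition coord_space :: "nat \<Rightarrow> (nat \<Rightarrow> 'a::{field,finite}) set" where
  "coord_space n = {f. \<forall>i\<ge>n. f i = 0}"

text \<open>The restriction to \<open>coord_space n\<close> makes the map extensional, as membership
  in \<open>lin_maps\<close> demands.\<close>

definition mat_map :: "nat \<Rightarrow> 'a::{field,finite} mat \<Rightarrow> (nat \<Rightarrow> 'a) \<Rightarrow> nat \<Rightarrow> 'a" where
  "mat_map n M = (\<lambda>v\<in>coord_space n. \<lambda>i. if i < n then \<Sum>j<n. M $$ (i, j) * v j else 0)"

definition unit_fun :: "nat \<Rightarrow> nat \<Rightarrow> 'a::{field,finite}" where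
  "unit_fun j i = (if i = j then 1 else 0)"

lemma has_dim_coord_space: "vs.has_dim (coord_space n :: (nat \<Rightarrow> 'a::{field,finite}) set) n"
proof -
  have "vs.subspace (coord_space n :: (nat \<Rightarrow> 'a) set)"
    by (auto simp: vs.subspace_def coord_space_def)
  moreover have "bij_betw (\<lambda>f. restrict f {..<n}) (coord_space n :: (nat \<Rightarrow> 'a) set) ({..<n} \<rightarrow>\<^sub>E UNIV)"
    by (rule bij_betwI[where g = "\<lambda>f i. if i < n then f i else 0"])
      (auto simp: coord_space_def fun_eq_iff PiE_def extensional_def)
  hence "card (coord_space n :: (nat \<Rightarrow> 'a) set) = CARD('a) ^ n"
    by (simp add: bij_betw_same_card card_funcsetE)
  ultimately show ?thesis by (simp add: vs.has_dim_def)
qed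

lemma subspace_coord_space: "vs.subspace (coord_space n)"
  by (rule vs.has_dim_subspace[OF has_dim_coord_space])

lemma finite_coord_space: "finite (coord_space n :: (nat \<Rightarrow> 'a::{field,finite}) set)"
  by (rule vs.has_dim_finite[OF has_dim_coord_space])

lemma unit_fun_in: "j < n \<Longrightarrow> unit_fun j \<in> coord_space n"
  by (auto simp: coord_space_def unit_fun_def)

lemma mat_map_in: "v \<in> coord_space n \<Longrightarrow> mat_map n M v \<in> coord_space n"
  by (auto simp: mat_map_def coord_space_def)

lemma mat_map_lin: "mat_map n M \<in> vs.lin_maps (coord_space n) (coord_space n)"
proof (rule vs.linI)
  fix x y :: "nat \<Rightarrow> 'a" assume xy: "x \<in> coord_space n" "y \<in> coord_space n"
  hence "x + y \<in> coord_space n" by (rule vs.subspace_add[OF subspace_coord_space])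
  thus "mat_map n M (x + y) = mat_map n M x + mat_map n M y"
    using xy by (auto simp: mat_map_def fun_eq_iff algebra_simps sum.distrib)
next
  fix c and x :: "nat \<Rightarrow> 'a" assume x: "x \<in> coord_space n"
  hence "(\<lambda>i. c * x i) \<in> coord_space n" by (rule vs.subspace_scale[OF subspace_coord_space])
  thus "mat_map n M (\<lambda>i. c * x i) = (\<lambda>i. c * mat_map n M x i)"
    using x by (auto simp: mat_map_def fun_eq_iff sum_distrib_left algebra_simps)
qed (auto intro: mat_map_in, simp add: mat_map_def)

lemma mat_map_unit: "j < n \<Longrightarrow> i < n \<Longrightarrow> mat_map n M (unit_fun j) i = M $$ (i, j)"
  by (simp add: mat_map_def unit_fun_in) (simp add: unit_fun_def if_distrib cong: if_cong)

lemma mat_map_inj: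
  assumes "M \<in> carrier_mat n n" "N \<in> carrier_mat n n"
    and "\<And>v. v \<in> coord_space n \<Longrightarrow> mat_map n M v = mat_map n N v"
  shows "M = N"
proof (rule eq_matI)
  fix i j assume "i < dim_row N" "j < dim_col N"
  hence "i < n" "j < n" using assms by auto
  thus "M $$ (i, j) = N $$ (i, j)" using mat_map_unit assms(3)[OF unit_fun_in] by metis
qed (use assms in auto)

lemma sum_fun_apply: "(\<Sum>j\<in>J. g j) i = (\<Sum>j\<in>J. g j i)"
  for g :: "'b \<Rightarrow> 'c \<Rightarrow> 'd::comm_monoid_add"
  by (induction J rule: infinite_finite_induct) auto

text \<open>The columns of the matrix are the images of the unit vectors.\<close>

lemma mat_map_surj:
  assumes f: "f \<in> vs.lin_maps (coord_space n) (coord_space n)"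
  obtains M where "M \<in> carrier_mat n n" "mat_map n M = f"
proof -
  define M where "M = mat n n (\<lambda>(i, j). f (unit_fun j) i)"
  \<comment> \<open>Membership is carried through the induction because \<open>f\<close> is additive
    only on \<open>coord_space n\<close>.\<close>
  have fsum: "f (\<Sum>j\<in>J. g j) = (\<Sum>j\<in>J. f (g j)) \<and> (\<Sum>j\<in>J. g j) \<in> coord_space n"
    if "finite J" "\<And>j. j \<in> J \<Longrightarrow> g j \<in> coord_space n" for g :: "nat \<Rightarrow> nat \<Rightarrow> 'a" and J
    using that
  proof (induction J rule: finite_induct)
    case empty
    have "f 0 = 0" "0 \<in> coord_space n"
      by (rule vs.lin_zero[OF f subspace_coord_space], rule vs.subspace_0[OF subspace_coord_space])
    thus ?case by (simp only: sum.empty)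
  next
    case (insert x J)
    hence g: "g x \<in> coord_space n" "(\<Sum>j\<in>J. g j) \<in> coord_space n"
      and e: "f (\<Sum>j\<in>J. g j) = (\<Sum>j\<in>J. f (g j))" by auto
    show ?case
      using vs.lin_add[OF f g] vs.subspace_add[OF subspace_coord_space g]
      unfolding sum.insert[OF insert.hyps] e by blast
  qed
  have "mat_map n M = f"
  proof (rule vs.lin_eqI[OF mat_map_lin f])
    fix v :: "nat \<Rightarrow> 'a" assume v: "v \<in> coord_space n"
    have dec: "v = (\<Sum>j<n. (\<lambda>i. v j * unit_fun j i))"
      using v by (auto simp: fun_eq_iff sum_fun_apply unit_fun_def coord_space_def if_distrib cong: if_cong)
    have uin: "(\<lambda>i. v j * unit_fun j i) \<in> coord_space n" if "j < n" for j
      by (rule vs.subspace_scale[OF subspace_coord_space unit_fun_in[OF that]])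
    have "f v = (\<Sum>j<n. f (\<lambda>i. v j * unit_fun j i))"
      using fsum[of "{..<n}" "\<lambda>j i. v j * unit_fun j i"] uin dec by simp
    also have "\<dots> = (\<Sum>j<n. (\<lambda>i. v j * f (unit_fun j) i))"
      using vs.lin_scale[OF f unit_fun_in] by (intro sum.cong refl) simp
    finally have fv: "f v i = (\<Sum>j<n. v j * f (unit_fun j) i)" for i by (simp add: sum_fun_apply)
    show "mat_map n M v = f v"
    proof
      fix i
      show "mat_map n M v i = f v i"
      proof (cases "i < n")
        case True
        thus ?thesis using v fv[of i] by (simp add: mat_map_def M_def mult.commute)
      next
        case False
        thus ?thesis using v vs.lin_in[OF f v] by (simp add: mat_map_def coord_space_def)
      qed
    qed
  qed
  thus ?thesis using that[of M] by (simp add: M_def)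
qed

lemma mat_map_mult:
  assumes "M \<in> carrier_mat n n" "N \<in> carrier_mat n n" "v \<in> coord_space n"
  shows "mat_map n (M * N) v = mat_map n M (mat_map n N v)"
proof
  fix i
  show "mat_map n (M * N) v i = mat_map n M (mat_map n N v) i"
  proof (cases "i < n")
    case True
    have "(\<Sum>j<n. (M * N) $$ (i, j) * v j) = (\<Sum>j<n. \<Sum>k<n. M $$ (i, k) * N $$ (k, j) * v j)"
      using assms True by (intro sum.cong refl) (simp add: scalar_prod_def sum_distrib_right lessThan_atLeast0)
    also have "\<dots> = (\<Sum>k<n. \<Sum>j<n. M $$ (i, k) * N $$ (k, j) * v j)" by (rule sum.swap)
    also have "\<dots> = (\<Sum>k<n. M $$ (i, k) * mat_map n N v k)"
      using assms by (intro sum.cong refl) (simp add: mat_map_def sum_distrib_left mult.assoc)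
    finally show ?thesis using True assms mat_map_in[OF assms(3), of N] by (simp add: mat_map_def[of n "M * N"] mat_map_def[of n M])
  next
    case False
    thus ?thesis using assms mat_map_in[OF assms(3), of N] by (simp add: mat_map_def[of n "M * N"] mat_map_def[of n M])
  qed
qed

lemma mat_map_one: "v \<in> coord_space n \<Longrightarrow> mat_map n (1\<^sub>m n) v = v"
  by (auto simp: mat_map_def fun_eq_iff coord_space_def if_distrib[of "\<lambda>x. x * _"] cong: if_cong)

lemma mat_map_zero: "v \<in> coord_space n \<Longrightarrow> mat_map n (0\<^sub>m n n) v = 0"
  by (auto simp: mat_map_def fun_eq_iff)

lemma mat_map_pow:
  assumes "M \<in> carrier_mat n n" "v \<in> coord_space n"
  shows "mat_map n (M ^\<^sub>m k) v = (mat_map n M ^^ k) v"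
  using assms(2)
proof (induction k arbitrary: v)
  case 0 thus ?case using assms by (simp add: mat_map_one)
next
  case (Suc k)
  thus ?case using assms
    by (simp add: mat_map_mult pow_carrier_mat mat_map_in funpow_swap1)
qed

section \<open>Nilpotency, commutation and invertibility of matrices in terms of maps\<close>

lemma nilpotent_mat_iff:
  assumes "M \<in> carrier_mat n n"
  shows "nilpotent_mat M \<longleftrightarrow> vs.nilpotent_on (coord_space n) (mat_map n M)"
proof -
  have "M ^\<^sub>m k = 0\<^sub>m n n \<longleftrightarrow> (\<forall>v\<in>coord_space n. (mat_map n M ^^ k) v = 0)" for k
  proof
    assume "M ^\<^sub>m k = 0\<^sub>m n n"
    thus "\<forall>v\<in>coord_space n. (mat_map n M ^^ k) v = 0"
      using mat_map_pow[OF assms, of _ k] mat_map_zero by metis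
  next
    assume "\<forall>v\<in>coord_space n. (mat_map n M ^^ k) v = 0"
    thus "M ^\<^sub>m k = 0\<^sub>m n n"
      by (intro mat_map_inj[of _ n]) (simp_all add: assms pow_carrier_mat mat_map_pow[OF assms] mat_map_zero)
  qed
  thus ?thesis using assms by (auto simp: nilpotent_mat_def vs.nilpotent_on_def)
qed

lemma card_commuting_nilpotent_pairs:
  "card (commuting_nilpotent_pairs n :: ('a::{field,finite} mat \<times> 'a mat) set) =
   card (vs.commuting_nilpotents (coord_space n :: (nat \<Rightarrow> 'a) set))"
proof (rule bij_betw_same_card[of "map_prod (mat_map n) (mat_map n)"], unfold bij_betw_def, intro conjI)
  let ?V = "coord_space n :: (nat \<Rightarrow> 'a) set"
  have com: "M * N = N * M \<longleftrightarrow> (\<forall>v\<in>?V. mat_map n M (mat_map n N v) = mat_map n N (mat_map n M v))"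
    if "M \<in> carrier_mat n n" "N \<in> carrier_mat n n" for M N :: "'a mat"
  proof
    assume "M * N = N * M"
    thus "\<forall>v\<in>?V. mat_map n M (mat_map n N v) = mat_map n N (mat_map n M v)"
      using mat_map_mult that by metis
  next
    assume "\<forall>v\<in>?V. mat_map n M (mat_map n N v) = mat_map n N (mat_map n M v)"
    thus "M * N = N * M" using that by (intro mat_map_inj[of _ n]) (simp_all add: mat_map_mult)
  qed
  show "inj_on (map_prod (mat_map n) (mat_map n)) (commuting_nilpotent_pairs n :: ('a mat \<times> 'a mat) set)"
    by (rule inj_onI) (auto simp: commuting_nilpotent_pairs_def intro: mat_map_inj)
  show "map_prod (mat_map n) (mat_map n) ` commuting_nilpotent_pairs n = vs.commuting_nilpotents ?V"
  proof (intro equalityI subsetI)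
    fix p :: "((nat \<Rightarrow> 'a) \<Rightarrow> (nat \<Rightarrow> 'a)) \<times> ((nat \<Rightarrow> 'a) \<Rightarrow> (nat \<Rightarrow> 'a))"
    assume "p \<in> map_prod (mat_map n) (mat_map n) ` commuting_nilpotent_pairs n"
    thus "p \<in> vs.commuting_nilpotents ?V"
      by (auto simp: commuting_nilpotent_pairs_def vs.commuting_nilpotents_def mat_map_lin nilpotent_mat_iff com)
  next
    fix p assume p: "p \<in> vs.commuting_nilpotents ?V"
    obtain A B where AB: "p = (A, B)" by fastforce
    hence "A \<in> vs.lin_maps ?V ?V" "B \<in> vs.lin_maps ?V ?V" using p by (auto simp: vs.commuting_nilpotents_def)
    then obtain M N where MN: "M \<in> carrier_mat n n" "mat_map n M = A" "N \<in> carrier_mat n n" "mat_map n N = B"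
      using mat_map_surj by metis
    have "(M, N) \<in> commuting_nilpotent_pairs n"
      using p MN unfolding AB by (auto simp: commuting_nilpotent_pairs_def vs.commuting_nilpotents_def nilpotent_mat_iff com)
    thus "p \<in> map_prod (mat_map n) (mat_map n) ` commuting_nilpotent_pairs n"
      using MN AB by (intro image_eqI[of _ _ "(M, N)"]) auto
  qed
qed

text \<open>On a finite space an injective endomorphism is bijective; its inverse is linear and
  hence again given by a matrix.\<close>

lemma invertible_mat_iff:
  assumes "M \<in> carrier_mat n n"
  shows "invertible_mat M \<longleftrightarrow> (\<forall>v\<in>coord_space n. mat_map n M v = 0 \<longrightarrow> v = 0)"
proof
  assume "invertible_mat M"
  then obtain N where N: "inverts_mat M N" "inverts_mat N M" by (auto simp: invertible_mat_def)
  have e: "M * N = 1\<^sub>m n" "N * M = 1\<^sub>m (dim_row N)" using N assms by (auto simp: inverts_mat_def)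
  \<comment> \<open>\<open>inverts_mat\<close> leaves the shape of \<open>N\<close> open; comparing
    dimensions in the two products forces it to be \<open>n\<close> by \<open>n\<close>.\<close>
  have "dim_col (M * N) = n" "dim_col (N * M) = dim_row N" using e by simp_all
  hence Nc: "N \<in> carrier_mat n n" using assms by auto
  show "\<forall>v\<in>coord_space n. mat_map n M v = 0 \<longrightarrow> v = 0"
  proof (intro ballI impI)
    fix v :: "nat \<Rightarrow> 'a" assume v: "v \<in> coord_space n" "mat_map n M v = 0"
    have "v = mat_map n (N * M) v" using e Nc v by (simp add: mat_map_one)
    also have "\<dots> = mat_map n N 0" using mat_map_mult[OF Nc assms v(1)] v by simp
    finally show "v = 0" using vs.lin_zero[OF mat_map_lin subspace_coord_space] by metis
  qed
next
  assume k: "\<forall>v\<in>coord_space n. mat_map n M v = 0 \<longrightarrow> v = 0"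
  let ?V = "coord_space n :: (nat \<Rightarrow> 'a) set"
  let ?f = "mat_map n M"
  note fl = mat_map_lin[of n M]
  have inj: "inj_on ?f ?V" using vs.lin_inj_iff[OF fl subspace_coord_space] k by simp
  have im: "?f ` ?V = ?V"
    by (rule endo_inj_surj[OF finite_coord_space _ inj]) (auto intro: mat_map_in)
  define g where "g = (\<lambda>x\<in>?V. inv_into ?V ?f x)"
  have gf: "g (?f x) = x" if "x \<in> ?V" for x using that inj mat_map_in[OF that] by (simp add: g_def)
  have fg: "?f (g x) = x" "g x \<in> ?V" if "x \<in> ?V" for x
    using that im f_inv_into_f[of x ?f ?V] inv_into_into[of x ?f ?V] by (simp_all add: g_def)
  have "g \<in> vs.lin_maps ?V ?V"
  proof (rule vs.linI)
    fix x y assume xy: "x \<in> ?V" "y \<in> ?V"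
    have "x + y = ?f (g x + g y)" using vs.lin_add[OF fl] fg xy by simp
    thus "g (x + y) = g x + g y" using gf vs.subspace_add[OF subspace_coord_space] fg xy by metis
  next
    fix c x assume x: "x \<in> ?V"
    have "(\<lambda>i. c * x i) = ?f (\<lambda>i. c * g x i)" using vs.lin_scale[OF fl] fg x by simp
    thus "g (\<lambda>i. c * x i) = (\<lambda>i. c * g x i)"
      using gf vs.subspace_scale[OF subspace_coord_space fg(2)[OF x]] by metis
  qed (auto simp: fg, simp add: g_def)
  then obtain N where N: "N \<in> carrier_mat n n" "mat_map n N = g" using mat_map_surj by metis
  have "M * N = 1\<^sub>m n"
    by (rule mat_map_inj[of _ n]) (use assms N in \<open>simp_all add: mat_map_mult mat_map_one fg\<close>)
  moreover have "N * M = 1\<^sub>m n"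
    by (rule mat_map_inj[of _ n]) (use assms N in \<open>simp_all add: mat_map_mult mat_map_one gf\<close>)
  ultimately show "invertible_mat M"
    using assms N by (auto simp: invertible_mat_def inverts_mat_def)
qed

lemma card_GL: "real (card (GL n :: 'a::{field,finite} mat set)) = finite_field_space.frames CARD('a) n n"
proof -
  let ?V = "coord_space n :: (nat \<Rightarrow> 'a) set"
  have "bij_betw (mat_map n) (GL n) {f \<in> vs.lin_maps ?V ?V. \<forall>c\<in>?V. f c = 0 \<longrightarrow> c = 0}"
    unfolding bij_betw_def
  proof
    show "inj_on (mat_map n) (GL n :: 'a mat set)"
      by (rule inj_onI) (auto simp: GL_def intro: mat_map_inj)
    show "mat_map n ` GL n = {f \<in> vs.lin_maps ?V ?V. \<forall>c\<in>?V. f c = 0 \<longrightarrow> c = 0}"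
    proof (intro equalityI subsetI)
      fix f assume f: "f \<in> {f \<in> vs.lin_maps ?V ?V. \<forall>c\<in>?V. f c = 0 \<longrightarrow> c = 0}"
      then obtain M where M: "M \<in> carrier_mat n n" "mat_map n M = f" using mat_map_surj by blast
      hence "M \<in> GL n" using f invertible_mat_iff[OF M(1)] by (simp add: GL_def)
      thus "f \<in> mat_map n ` GL n" using M by blast
    qed (auto simp: GL_def mat_map_lin invertible_mat_iff)
  qed
  hence "card (GL n :: 'a mat set) = card {f \<in> vs.lin_maps ?V ?V. \<forall>c\<in>?V. f c = 0 \<longrightarrow> c = 0}"
    by (rule bij_betw_same_card)
  thus ?thesis using vs.card_injective[OF has_dim_coord_space has_dim_coord_space, where 'a = 'a] by (simp only:)
qed

lemma card_pairs_over_card_GL: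
  "real (card (commuting_nilpotent_pairs n :: ('a::{field,finite} mat \<times> 'a mat) set)) / real (card (GL n :: 'a mat set)) =
   (\<Sum>m\<le>n. strata (euler_coeff (1 / real CARD('a))) n m)"
proof -
  have w: "finite_field_space.weight CARD('a) = euler_coeff (1 / real CARD('a))"
    using vs.weight_eq_euler_coeff[where 'a = 'a] by (rule ext)
  have "real (card (commuting_nilpotent_pairs n :: ('a mat \<times> 'a mat) set)) =
    finite_field_space.frames CARD('a) n n * (\<Sum>m\<le>n. strata (euler_coeff (1 / real CARD('a))) n m)"
    unfolding card_commuting_nilpotent_pairs using vs.card_commuting_nilpotents[OF has_dim_coord_space[where 'a = 'a]] w by metis
  moreover have "finite_field_space.frames CARD('a) n n > 0" using vs.frames_pos[of n n, where 'a = 'a] by simp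
  ultimately show ?thesis by (simp add: card_GL)
qed

theorem theorem2p7:
  fixes q :: nat
  assumes "q = CARD('a :: {field, finite})"
  shows "(\<forall>i\<ge>1. fps_convergent_infprod
             (\<lambda>l. 1 / (1 - fps_const (1 / real q ^ l) * fps_X ^ i))) \<and>
         fps_convergent_infprod
           (\<lambda>i. fps_infprod (\<lambda>l. 1 / (1 - fps_const (1 / real q ^ l) * fps_X ^ i))) \<and>
         Abs_fps (\<lambda>n. real (card (commuting_nilpotent_pairs n :: ('a mat \<times> 'a mat) set))
                        / real (card (GL n :: 'a mat set))) =
           fps_infprod (\<lambda>i. fps_infprod
             (\<lambda>l. 1 / (1 - fps_const (1 / real q ^ l) * fps_X ^ i)))"
proof -
  define a where "a = euler_coeff (1 / real q)"
  let ?f = "\<lambda>i l. 1 / (1 - fps_const (1 / real q ^ l) * fps_X ^ i)"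
  have "q \<ge> 2" using vs.q_ge_2[where 'a = 'a] assms by simp
  hence p: "0 < 1 / real q" "1 / real q < 1" by simp_all
  have inner: "fps_has_infprod (?f i) (dilate i a)" if "i \<ge> 1" for i
    using fps_has_infprod_euler[OF p, of i] that by (simp add: a_def power_one_over)
  \<comment> \<open>The inner products are identified for \<open>i \<ge> 1\<close>, which is where
    the partial products begin.\<close>
  have "(\<Prod>i=1..N. fps_infprod (?f i)) = (\<Prod>i=1..N. dilate i a)" for N
    by (intro prod.cong refl fps_infprod_eqI inner) simp
  moreover have "a 0 = 1" by (simp add: a_def euler_coeff_def)
  ultimately have outer: "fps_has_infprod (\<lambda>i. fps_infprod (?f i)) (strata_fps a 0)"
    using fps_has_infprod_dilate[of a] by (simp add: fps_has_infprod_def)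
  \<comment> \<open>At \<open>k = 0\<close> the coefficient \<open>n\<close> of
    \<open>strata_fps\<close> sums the normalised counts over all nullities
    \<open>m \<le> n\<close>.\<close>
  have "Abs_fps (\<lambda>n. real (card (commuting_nilpotent_pairs n :: ('a mat \<times> 'a mat) set))
                        / real (card (GL n :: 'a mat set))) = strata_fps a 0"
    by (simp add: card_pairs_over_card_GL strata_fps_def a_def assms atMost_def)
  thus ?thesis using inner outer fps_infprod_eqI[OF outer] by (auto simp: fps_convergent_infprod_def)
qed

end
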